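(* Let $M$ be a complete metric space. Then $\mathcal{F}(M)$ is weakly sequentially complete if and only if $\mathcal{F}(K)$ is weakly sequentially complete for every compact $K\subset M$.
   Context: All metric spaces come with a distinguished base point $0$. $\mathrm{Lip}_0(M)$ is the Banach space of real-valued Lipschitz functions $f$ on $M$ with $f(0)=0$, normed by the best Lipschitz constant. For $x\in M$ let $\delta(x)\in\mathrm{Lip}_0(M)^*$ be $\delta(x)(f)=f(x)$. The Lipschitz-free space is $\mathcal{F}(M)=\overline{\operatorname{span}}\{\delta(x):x\in M\}\subset\mathrm{Lip}_0(M)^*$ (norm closure). For $N\subset M$, $\mathcal{F}(N)$ is identified with the closed subspace $\overline{\operatorname{span}}\{\delta(x):x\in N\}$ of $\mathcal{F}(M)$ (canonically isometric to the free space over $N\cup\{0\}$). A sequence $(x_n)$ in a Banach space $X$ is weakly Cauchy if $(\langle x^*,x_n\rangle)_n$ converges for every $x^*\in X^*$. $X$ is weakly sequentially complete if every weakly Cauchy sequence in $X$ is weakly convergent in $X$. *)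

theory Defs
  imports "HOL-Analysis.Analysis"
begin

text \<open>
  A pointed metric space is a type of sort \<open>{metric_space, zero}\<close>: the class \<open>zero\<close> has no
  axioms, so \<open>0\<close> is just an arbitrary point that serves as the base point.
\<close>

typedef (overloaded) 'a lip0 =
  "{f :: 'a::{metric_space,zero} \<Rightarrow> real. f 0 = 0 \<and> (\<exists>C. C-lipschitz_on UNIV f)}"
  morphisms lip0_apply Abs_lip0
  by (rule exI[of _ "\<lambda>_. 0"]) (auto simp: lipschitz_on_def)

setup_lifting type_definition_lip0

lemma lip0_apply_base [simp]: "lip0_apply f 0 = 0"
  using lip0_apply[of f] by simp

lemma lip0_eqI: "(\<And>x. lip0_apply f x = lip0_apply g x) \<Longrightarrow> f = g"
  by (simp add: lip0_apply_inject[symmetric] fun_eq_iff)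

instantiation lip0 :: ("{metric_space,zero}") real_vector
begin

lift_definition zero_lip0 :: "'a lip0" is "\<lambda>_. 0"
  by (auto simp: lipschitz_on_def)

lift_definition plus_lip0 :: "'a lip0 \<Rightarrow> 'a lip0 \<Rightarrow> 'a lip0" is "\<lambda>f g x. f x + g x"
  by (auto intro: lipschitz_on_add)

lift_definition minus_lip0 :: "'a lip0 \<Rightarrow> 'a lip0 \<Rightarrow> 'a lip0" is "\<lambda>f g x. f x - g x"
  by (auto intro: lipschitz_on_diff)

lift_definition uminus_lip0 :: "'a lip0 \<Rightarrow> 'a lip0" is "\<lambda>f x. - f x"
  by (auto simp: lipschitz_on_minus)

lift_definition scaleR_lip0 :: "real \<Rightarrow> 'a lip0 \<Rightarrow> 'a lip0" is "\<lambda>c f x. c * f x"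
  by (auto intro: lipschitz_on_cmult_real)

instance
  by standard (rule lip0_eqI; transfer; simp add: algebra_simps)+

end

instantiation lip0 :: ("{metric_space,zero}") real_normed_vector
begin

text \<open>The best Lipschitz constant; \<open>C-lipschitz_on\<close> includes \<open>0 \<le> C\<close>.\<close>

definition norm_lip0 :: "'a lip0 \<Rightarrow> real"
  where "norm_lip0 f = Inf {C. C-lipschitz_on UNIV (lip0_apply f)}"

definition dist_lip0 :: "'a lip0 \<Rightarrow> 'a lip0 \<Rightarrow> real"
  where "dist_lip0 f g = norm (f - g)"

definition sgn_lip0 :: "'a lip0 \<Rightarrow> 'a lip0"
  where "sgn_lip0 f = f /\<^sub>R norm f"

definition uniformity_lip0 :: "('a lip0 \<times> 'a lip0) filter"
  where "uniformity_lip0 = (INF e\<in>{0<..}. principal {(f, g). dist f g < e})"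

definition open_lip0 :: "'a lip0 set \<Rightarrow> bool"
  where "open_lip0 U \<longleftrightarrow> (\<forall>f\<in>U. eventually (\<lambda>(f', g). f' = f \<longrightarrow> g \<in> U) uniformity)"

lemma norm_lip0_lipschitz: "(norm f)-lipschitz_on UNIV (lip0_apply f)" for f :: "'a lip0"
proof (rule lipschitz_onI)
  let ?S = "{C. C-lipschitz_on UNIV (lip0_apply f)}"
  have ne: "?S \<noteq> {}" using lip0_apply[of f] by auto
  show "0 \<le> norm f"
    unfolding norm_lip0_def by (rule cInf_greatest[OF ne]) (auto dest: lipschitz_on_nonneg)
  fix x y :: 'a
  show "dist (lip0_apply f x) (lip0_apply f y) \<le> norm f * dist x y"
  proof (cases "x = y")
    case False
    then have pos: "0 < dist x y" by simp
    have "dist (lip0_apply f x) (lip0_apply f y) / dist x y \<le> norm f"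
      unfolding norm_lip0_def
      by (rule cInf_greatest[OF ne]) (use pos in \<open>auto simp: lipschitz_on_def divide_le_eq\<close>)
    with pos show ?thesis by (simp add: divide_le_eq)
  qed simp
qed

lemma norm_lip0_le: "C-lipschitz_on UNIV (lip0_apply f) \<Longrightarrow> norm f \<le> C" for f :: "'a lip0"
  unfolding norm_lip0_def
  by (rule cInf_lower) (auto intro!: bdd_belowI[of _ 0] dest: lipschitz_on_nonneg)

instance
proof
  fix f g :: "'a lip0" and c :: real
  show "dist f g = norm (f - g)" by (rule dist_lip0_def)
  show "sgn f = f /\<^sub>R norm f" by (rule sgn_lip0_def)
  show "uniformity = (INF e\<in>{0<..}. principal {(f :: 'a lip0, g). dist f g < e})"
    by (rule uniformity_lip0_def)
  show "open U \<longleftrightarrow> (\<forall>f\<in>U. eventually (\<lambda>(f', g). f' = f \<longrightarrow> g \<in> U) uniformity)"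
    for U :: "'a lip0 set" by (rule open_lip0_def)
  show "norm f = 0 \<longleftrightarrow> f = 0"
  proof
    assume "norm f = 0"
    then have "dist (lip0_apply f x) (lip0_apply f 0) \<le> 0" for x
      using lipschitz_onD[OF norm_lip0_lipschitz[of f], of x 0] by simp
    then show "f = 0" by (intro lip0_eqI) (simp add: zero_lip0.rep_eq)
  next
    assume "f = 0"
    then have "norm f \<le> 0"
      by (intro norm_lip0_le) (simp add: zero_lip0.rep_eq lipschitz_on_def)
    then show "norm f = 0"
      using lipschitz_on_nonneg[OF norm_lip0_lipschitz[of f]] by simp
  qed
  show "norm (f + g) \<le> norm f + norm g"
    by (rule norm_lip0_le)
      (simp add: plus_lip0.rep_eq lipschitz_on_add norm_lip0_lipschitz)
  have le: "norm (a *\<^sub>R h) \<le> \<bar>a\<bar> * norm h" for a :: real and h :: "'a lip0"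
    by (rule norm_lip0_le)
      (simp add: scaleR_lip0.rep_eq lipschitz_on_cmult_real norm_lip0_lipschitz)
  show "norm (c *\<^sub>R f) = \<bar>c\<bar> * norm f"
  proof (cases "c = 0")
    case True
    then show ?thesis
      using le[of c f] lipschitz_on_nonneg[OF norm_lip0_lipschitz[of "c *\<^sub>R f"]] by simp
  next
    case False
    have "norm f \<le> \<bar>inverse c\<bar> * norm (c *\<^sub>R f)"
      using le[of "inverse c" "c *\<^sub>R f"] False by simp
    with False have "\<bar>c\<bar> * norm f \<le> norm (c *\<^sub>R f)"
      by (simp add: field_simps)
    with le[of c f] show ?thesis by simp
  qed
qed

end

lift_definition delta :: "'a::{metric_space,zero} \<Rightarrow> 'a lip0 \<Rightarrow>\<^sub>L real"
  is "\<lambda>x f. lip0_apply f x"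
proof (rule bounded_linear_intro)
  fix x :: 'a and f g :: "'a lip0" and c :: real
  show "lip0_apply (f + g) x = lip0_apply f x + lip0_apply g x"
    by (simp add: plus_lip0.rep_eq)
  show "lip0_apply (c *\<^sub>R f) x = c *\<^sub>R lip0_apply f x"
    by (simp add: scaleR_lip0.rep_eq)
  show "norm (lip0_apply f x) \<le> norm f * dist x 0"
    using lipschitz_onD[OF norm_lip0_lipschitz[of f], of x 0] by (simp add: dist_real_def)
qed

text \<open>
  \<open>lip_free N\<close> is \<open>\<F>(N)\<close> as a closed subspace of \<open>\<F>(M)\<close>, where \<open>M\<close> is the whole type;
  \<open>\<F>(M)\<close> itself is \<open>lip_free UNIV\<close>. As \<open>delta 0 = 0\<close>, it is irrelevant whether \<open>0 \<in> N\<close>.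
\<close>

definition lip_free :: "'a::{metric_space,zero} set \<Rightarrow> ('a lip0 \<Rightarrow>\<^sub>L real) set"
  where "lip_free N = closure (span (delta ` N))"

text \<open>
  The dual of a linear subspace \<open>X\<close>: the functionals that are linear and bounded on \<open>X\<close>.
  Their values outside \<open>X\<close> are arbitrary and never used below.
\<close>

definition dual_on :: "'b::real_normed_vector set \<Rightarrow> ('b \<Rightarrow> real) set"
  where "dual_on X = {\<phi>.
    (\<forall>x\<in>X. \<forall>y\<in>X. \<phi> (x + y) = \<phi> x + \<phi> y) \<and>
    (\<forall>c. \<forall>x\<in>X. \<phi> (c *\<^sub>R x) = c * \<phi> x) \<and>
    (\<exists>B. \<forall>x\<in>X. \<bar>\<phi> x\<bar> \<le> B * norm x)}"

definition weakly_Cauchy_in :: "'b::real_normed_vector set \<Rightarrow> (nat \<Rightarrow> 'b) \<Rightarrow> bool"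
  where "weakly_Cauchy_in X u \<longleftrightarrow>
    range u \<subseteq> X \<and> (\<forall>\<phi>\<in>dual_on X. convergent (\<lambda>n. \<phi> (u n)))"

definition weakly_convergent_in :: "'b::real_normed_vector set \<Rightarrow> (nat \<Rightarrow> 'b) \<Rightarrow> bool"
  where "weakly_convergent_in X u \<longleftrightarrow>
    range u \<subseteq> X \<and> (\<exists>x\<in>X. \<forall>\<phi>\<in>dual_on X. (\<lambda>n. \<phi> (u n)) \<longlonglongrightarrow> \<phi> x)"

definition weakly_sequentially_complete :: "'b::real_normed_vector set \<Rightarrow> bool"
  where "weakly_sequentially_complete X \<longleftrightarrow>
    (\<forall>u. weakly_Cauchy_in X u \<longrightarrow> weakly_convergent_in X u)"

end

theory Submission
  imports Defs
begin

text \<open>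
  Every functional on \<open>\<F>(N)\<close> is the evaluation at a Lipschitz function, by McShane extension, so
  weak convergence is pointwise convergence on \<open>Lip\<^sub>0(M)\<close>. For a compact \<open>K\<close>, the weak limit of a
  sequence in \<open>\<F>(K)\<close> stays in \<open>\<F>(K)\<close> by the Hahn-Banach theorem.

  Conversely, a gliding hump argument in the spirit of Kalton shows that a weakly Cauchy sequence
  is, up to a small error, concentrated near a finite set. Multiplication by Lipschitz cutoff
  functions therefore moves the sequence only a little and makes it live near a finite set.
  Iterating at finer and finer scales with summable errors, one obtains in the limit a weakly
  Cauchy sequence in \<open>\<F>(K)\<close> with \<open>K\<close> compact, uniformly close to the given one. Its weak limit
  exists by assumption, and as the error tends to \<open>0\<close> these limits converge in norm to the
  weak limit of the original sequence.
\<close>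

section \<open>The Hahn-Banach theorem\<close>

text \<open>The delicate point is the order of choices. Multiplication by a cutoff of parameter
  \<open>c\<close> has norm bound 1 + 2c, which grows as the scale gets finer; but the finite set is
  chosen after \<open>c\<close>, so the gliding hump can be run with its error divided by 2 + 2c. A
  cutoff acts on a functional by composition, so pairing the modified sequence with \<open>f\<close>
  means pairing the old one with another Lipschitz function. The modified sequence is therefore
  again weakly Cauchy, and the step can be repeated.

  After finitely many cutoffs a functional is only known to ignore functions that vanish on a finite
  intersection of neighbourhoods, whereas membership in \<open>lip_free K\<close> concerns all
  functions that vanish on \<open>K\<close>. The gap is bridged by truncating such a function at
  small heights: this changes it only away from \<open>K\<close>, and elements of the free space are
  continuous along bounded, pointwise convergent sequences.\<close>

definition sublinear :: "('b::real_vector \<Rightarrow> real) \<Rightarrow> bool"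
  where "sublinear p \<longleftrightarrow>
    (\<forall>x y. p (x + y) \<le> p x + p y) \<and> (\<forall>t\<ge>0. \<forall>x. p (t *\<^sub>R x) \<le> t * p x)"

lemma sublinear_add: "sublinear p \<Longrightarrow> p (x + y) \<le> p x + p y"
  by (simp add: sublinear_def)

lemma sublinear_scaleR_le: "sublinear p \<Longrightarrow> 0 \<le> t \<Longrightarrow> p (t *\<^sub>R x) \<le> t * p x"
  by (simp add: sublinear_def)

lemma sublinear_zero: "sublinear p \<Longrightarrow> p 0 = 0"
  using sublinear_scaleR_le[of p 0 0] sublinear_add[of p 0 0] by simp

lemma sublinear_scaleR:
  assumes "sublinear p" "0 \<le> t"
  shows "p (t *\<^sub>R x) = t * p x"
proof (cases "t = 0")
  case False
  with assms have "p (inverse t *\<^sub>R (t *\<^sub>R x)) \<le> inverse t * p (t *\<^sub>R x)"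
    by (intro sublinear_scaleR_le) auto
  with False assms have "t * p x \<le> p (t *\<^sub>R x)"
    by (simp add: field_simps)
  with sublinear_scaleR_le[OF assms] show ?thesis by (simp add: antisym)
qed (use sublinear_zero[OF assms(1)] in simp)

lemma sublinear_lower: "sublinear p \<Longrightarrow> - p (- x) \<le> p x"
  using sublinear_add[of p x "- x"] by (simp add: sublinear_zero)

text \<open>For sublinear \<open>p\<close> this is the largest sublinear functional below
  \<open>p\<close> whose value at \<open>- v\<close> is at most \<open>- p v\<close>. A linear
  functional below it therefore equals \<open>p v\<close> at \<open>v\<close>.\<close>

definition tilt :: "('b::real_vector \<Rightarrow> real) \<Rightarrow> 'b \<Rightarrow> 'b \<Rightarrow> real"
  where "tilt p v y = (INF t\<in>{0..}. p (y + t *\<^sub>R v) - t * p v)"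

lemma tilt_le:
  assumes "sublinear p" "0 \<le> t"
  shows "tilt p v y \<le> p (y + t *\<^sub>R v) - t * p v"
  unfolding tilt_def
proof (rule cINF_lower)
  show "bdd_below ((\<lambda>t. p (y + t *\<^sub>R v) - t * p v) ` {0..})"
  proof (rule bdd_belowI2)
    fix s :: real assume "s \<in> {0..}"
    then have "s * p v = p (s *\<^sub>R v)" using assms by (simp add: sublinear_scaleR)
    also have "\<dots> \<le> p (y + s *\<^sub>R v) + p (- y)"
      using sublinear_add[OF assms(1), of "y + s *\<^sub>R v" "- y"] by simp
    finally show "- p (- y) \<le> p (y + s *\<^sub>R v) - s * p v" by simp
  qed
qed (use assms in simp)

lemma tilt_greatest:
  "(\<And>t. 0 \<le> t \<Longrightarrow> c \<le> p (y + t *\<^sub>R v) - t * p v) \<Longrightarrow> c \<le> tilt p v y"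
  unfolding tilt_def by (rule cINF_greatest) auto

lemma tilt_le_self: "sublinear p \<Longrightarrow> tilt p v y \<le> p y"
  using tilt_le[of p 0 v y] by simp

lemma sublinear_tilt:
  assumes p: "sublinear p"
  shows "sublinear (tilt p v)"
  unfolding sublinear_def
proof (intro conjI allI impI)
  fix x y
  \<comment> \<open>The parameter \<open>t + s\<close> at \<open>x + y\<close> is split between the
    two summands; the infima over \<open>t\<close> and \<open>s\<close> are then taken one after the
    other.\<close>
  have "tilt p v (x + y) - (p (y + s *\<^sub>R v) - s * p v) \<le> tilt p v x" if "0 \<le> s" for s
  proof (rule tilt_greatest)
    fix t :: real assume "0 \<le> t"
    with that have "tilt p v (x + y) \<le> p ((x + y) + (t + s) *\<^sub>R v) - (t + s) * p v"
      by (intro tilt_le p) auto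
    also have "(x + y) + (t + s) *\<^sub>R v = (x + t *\<^sub>R v) + (y + s *\<^sub>R v)"
      by (simp add: algebra_simps)
    finally show "tilt p v (x + y) - (p (y + s *\<^sub>R v) - s * p v) \<le> p (x + t *\<^sub>R v) - t * p v"
      using sublinear_add[OF p, of "x + t *\<^sub>R v" "y + s *\<^sub>R v"] by (simp add: algebra_simps)
  qed
  then have "tilt p v (x + y) - tilt p v x \<le> tilt p v y"
    by (intro tilt_greatest) (simp add: algebra_simps)
  then show "tilt p v (x + y) \<le> tilt p v x + tilt p v y" by simp
next
  fix s :: real and x assume "0 \<le> s"
  show "tilt p v (s *\<^sub>R x) \<le> s * tilt p v x"
  proof (cases "s = 0")
    case True
    then show ?thesis using tilt_le_self[OF p, of v 0] by (simp add: sublinear_zero[OF p])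
  next
    case False
    with \<open>0 \<le> s\<close> have s: "0 < s" by simp
    have "inverse s * tilt p v (s *\<^sub>R x) \<le> tilt p v x"
    proof (rule tilt_greatest)
      fix t :: real assume "0 \<le> t"
      with s have "tilt p v (s *\<^sub>R x) \<le> p (s *\<^sub>R x + (s * t) *\<^sub>R v) - (s * t) * p v"
        by (intro tilt_le p) auto
      also have "s *\<^sub>R x + (s * t) *\<^sub>R v = s *\<^sub>R (x + t *\<^sub>R v)"
        by (simp add: algebra_simps)
      also have "p \<dots> = s * p (x + t *\<^sub>R v)"
        using s by (simp add: sublinear_scaleR[OF p])
      finally show "inverse s * tilt p v (s *\<^sub>R x) \<le> p (x + t *\<^sub>R v) - t * p v"
        using s by (simp add: field_simps)
    qed
    with s show ?thesis by (simp add: field_simps)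
  qed
qed

text \<open>Zorn's lemma for the reversed pointwise order. The infimum of a chain is finite because
  each member \<open>r\<close> satisfies - p (- x) \<le> - r (- x) \<le> r x, and it is subadditive
  because two members can be replaced by the smaller one.\<close>

lemma exists_minimal_sublinear:
  fixes p :: "'b::real_vector \<Rightarrow> real"
  assumes "sublinear p"
  obtains q where "sublinear q" "q \<le> p" "\<And>r. sublinear r \<Longrightarrow> r \<le> q \<Longrightarrow> r = q"
proof -
  define A where "A = {q. sublinear q \<and> q \<le> p}"
  have "\<exists>m\<in>A. \<forall>a\<in>A. m \<ge> a \<longrightarrow> a = m"
  proof (rule predicate_Zorn)
    show "partial_order_on A (relation_of (\<lambda>q r. q \<ge> r) A)"
      by (auto simp: partial_order_on_def preorder_on_def relation_of_def
          intro!: refl_onI transI antisymI)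
    fix C assume C: "C \<in> Chains (relation_of (\<lambda>q r. q \<ge> r) A)"
    then have CA: "C \<subseteq> A" and total: "\<And>q r. q \<in> C \<Longrightarrow> r \<in> C \<Longrightarrow> q \<le> r \<or> r \<le> q"
      by (auto simp: Chains_def relation_of_def)
    show "\<exists>u\<in>A. \<forall>a\<in>C. a \<ge> u"
    proof (cases "C = {}")
      case True
      with assms show ?thesis by (auto simp: A_def)
    next
      case False
      define u where "u x = (INF q\<in>C. q x)" for x
      have low: "u x \<le> q x" if "q \<in> C" for q x
        unfolding u_def
      proof (rule cINF_lower[OF _ that])
        show "bdd_below ((\<lambda>q. q x) ` C)"
        proof (rule bdd_belowI2)
          fix r assume "r \<in> C"
          with CA have "sublinear r" "r (- x) \<le> p (- x)" by (auto simp: A_def le_fun_def)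
          then show "- p (- x) \<le> r x" using sublinear_lower[of r x] by linarith
        qed
      qed
      have great: "c \<le> u x" if "\<And>q. q \<in> C \<Longrightarrow> c \<le> q x" for c x
        unfolding u_def using False that by (rule cINF_greatest)
      have "sublinear u"
        unfolding sublinear_def
      proof (intro conjI allI impI)
        fix x y
        have "u (x + y) \<le> q x + r y" if q: "q \<in> C" and r: "r \<in> C" for q r
        proof -
          obtain s where s: "s \<in> C" "s \<le> q" "s \<le> r" using total[OF q r] q r by blast
          then have "sublinear s" using CA by (auto simp: A_def)
          then have "u (x + y) \<le> s x + s y"
            using low[OF s(1), of "x + y"] sublinear_add[of s x y] by linarith
          then show ?thesis
            using le_funD[OF s(2), of x] le_funD[OF s(3), of y] by linarith
        qed
        then have "u (x + y) - r y \<le> u x" if "r \<in> C" for r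
          using that by (intro great) (simp add: algebra_simps)
        then have "u (x + y) - u x \<le> u y"
          by (intro great) (simp add: algebra_simps)
        then show "u (x + y) \<le> u x + u y" by simp
      next
        fix t :: real and x assume t: "0 \<le> t"
        show "u (t *\<^sub>R x) \<le> t * u x"
        proof (cases "t = 0")
          case True
          obtain q where q: "q \<in> C" using False by blast
          with CA have "sublinear q" by (auto simp: A_def)
          with low[OF q, of 0] True show ?thesis by (simp add: sublinear_zero)
        next
          case False
          with t have t: "0 < t" by simp
          have "inverse t * u (t *\<^sub>R x) \<le> u x"
          proof (rule great)
            fix q assume q: "q \<in> C"
            with CA have "sublinear q" by (auto simp: A_def)
            then have "u (t *\<^sub>R x) \<le> t * q x"
              using low[OF q, of "t *\<^sub>R x"] t by (simp add: sublinear_scaleR)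
            with t show "inverse t * u (t *\<^sub>R x) \<le> q x" by (simp add: field_simps)
          qed
          with t show ?thesis by (simp add: field_simps)
        qed
      qed
      moreover have "u \<le> p"
      proof (rule le_funI)
        fix x
        obtain q where q: "q \<in> C" using False by blast
        with CA have "q x \<le> p x" by (auto simp: A_def le_fun_def)
        with low[OF q, of x] show "u x \<le> p x" by simp
      qed
      ultimately show ?thesis using low by (auto simp: A_def le_fun_def)
    qed
  qed
  then obtain m where m: "m \<in> A" "\<forall>a\<in>A. m \<ge> a \<longrightarrow> a = m" by blast
  show thesis
  proof (rule that[of m])
    fix r assume r: "sublinear r" "r \<le> m"
    moreover have "r \<in> A" using m r by (auto simp: A_def intro: order_trans)
    ultimately show "r = m" using m by blast
  qed (use m in \<open>auto simp: A_def\<close>)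
qed

text \<open>A minimal sublinear functional coincides with all its tilts, which makes it additive.\<close>

theorem sublinear_dominates_linear:
  fixes p :: "'b::real_vector \<Rightarrow> real"
  assumes p: "sublinear p"
  obtains \<phi> where "linear \<phi>" "\<And>x. \<phi> x \<le> p x" "\<phi> v = p v"
proof -
  \<comment> \<open>Going down from the tilt instead of from \<open>p\<close> forces
    \<open>q (- v)\<close> \<le> \<open>- p v\<close>, hence equality at \<open>v\<close>.\<close>
  obtain q where q: "sublinear q" "q \<le> tilt p v"
    and min: "\<And>r. sublinear r \<Longrightarrow> r \<le> q \<Longrightarrow> r = q"
    using exists_minimal_sublinear[OF sublinear_tilt[OF p, of v]] by metis
  have add: "q (x + y) = q x + q y" for x y
  proof -
    have "tilt q x = q"
      using q(1) by (intro min sublinear_tilt) (auto simp: le_fun_def tilt_le_self)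
    then have "q y \<le> q (y + x) - q x"
      using tilt_le[OF q(1), of 1 x y] by simp
    then show ?thesis
      using sublinear_add[OF q(1), of x y] by (simp add: add.commute)
  qed
  have neg: "q (- x) = - q x" for x
    using add[of x "- x"] by (simp add: sublinear_zero[OF q(1)])
  have scale: "q (t *\<^sub>R x) = t * q x" for t x
  proof (cases "0 \<le> t")
    case False
    then have "q ((- t) *\<^sub>R x) = - t * q x" by (intro sublinear_scaleR q) simp
    then show ?thesis using neg[of "t *\<^sub>R x"] by simp
  qed (simp add: sublinear_scaleR[OF q(1)])
  have le: "q x \<le> p x" for x
    using le_funD[OF q(2), of x] tilt_le_self[OF p, of v x] by linarith
  have "q (- v) \<le> - p v"
    using le_funD[OF q(2), of "- v"] tilt_le[OF p, of 1 v "- v"] by (simp add: sublinear_zero[OF p])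
  with le[of v] have "q v = p v" by (simp add: neg)
  with le show thesis
    by (intro that[of q]) (auto intro!: linearI simp: add scale)
qed

lemma sublinear_infdist:
  fixes S :: "'b::real_normed_vector set"
  assumes S: "subspace S"
  shows "sublinear (\<lambda>x. infdist x S)"
proof -
  have ne: "S \<noteq> {}" using subspace_0[OF S] by blast
  have great: "c \<le> infdist x S" if "\<And>a. a \<in> S \<Longrightarrow> c \<le> dist x a" for c x
    using ne that by (auto simp: infdist_notempty intro: cINF_greatest)
  show ?thesis
    unfolding sublinear_def
  proof (intro conjI allI impI)
    fix x y
    have "infdist (x + y) S \<le> dist x a + dist y b" if "a \<in> S" "b \<in> S" for a b
      using infdist_le[OF subspace_add[OF S that], of "x + y"] dist_triangle_add[of x y a b]
      by linarith
    then have "infdist (x + y) S - dist y b \<le> infdist x S" if "b \<in> S" for b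
      using that by (intro great) (simp add: algebra_simps)
    then have "infdist (x + y) S - infdist x S \<le> infdist y S"
      by (intro great) (simp add: algebra_simps)
    then show "infdist (x + y) S \<le> infdist x S + infdist y S" by simp
  next
    fix t :: real and x assume t: "0 \<le> t"
    show "infdist (t *\<^sub>R x) S \<le> t * infdist x S"
    proof (cases "t = 0")
      case False
      with t have t: "0 < t" by simp
      have "inverse t * infdist (t *\<^sub>R x) S \<le> infdist x S"
      proof (rule great)
        fix a assume "a \<in> S"
        then have "infdist (t *\<^sub>R x) S \<le> dist (t *\<^sub>R x) (t *\<^sub>R a)"
          by (intro infdist_le subspace_scale S)
        also have "\<dots> = t * dist x a" using t by (simp add: dist_norm flip: scaleR_diff_right)
        finally show "inverse t * infdist (t *\<^sub>R x) S \<le> dist x a"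
          using t by (simp add: field_simps)
      qed
      with t show ?thesis by (simp add: field_simps)
    qed (simp add: subspace_0[OF S])
  qed
qed

text \<open>Apply domination to the distance from \<open>S\<close>: on \<open>S\<close> the
  functional is at most 0 at both \<open>x\<close> and \<open>- x\<close>, it is contractive because
  0 lies in \<open>S\<close>, and its value at \<open>v\<close> is the positive distance of
  \<open>v\<close> from \<open>S\<close>.\<close>

corollary separating_functional:
  fixes S :: "'b::real_normed_vector set"
  assumes S: "subspace S" "closed S" and v: "v \<notin> S"
  obtains \<phi> :: "'b \<Rightarrow> real"
    where "linear \<phi>" "\<And>x. \<bar>\<phi> x\<bar> \<le> norm x" "\<And>x. x \<in> S \<Longrightarrow> \<phi> x = 0" "\<phi> v \<noteq> 0"
proof -
  obtain \<phi> where \<phi>: "linear \<phi>" "\<And>x. \<phi> x \<le> infdist x S" "\<phi> v = infdist v S"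
    using sublinear_dominates_linear[OF sublinear_infdist[OF S(1)]] by blast
  have neg: "\<phi> (- x) = - \<phi> x" for x using \<phi>(1) by (rule linear_neg)
  have "infdist x S \<le> norm x" for x using infdist_le[OF subspace_0[OF S(1)], of x] by simp
  then have bd: "\<phi> x \<le> norm x" for x using \<phi>(2) order_trans by blast
  show thesis
  proof (rule that[OF \<phi>(1)])
    show "\<bar>\<phi> x\<bar> \<le> norm x" for x using bd[of x] bd[of "- x"] by (auto simp: neg)
    show "\<phi> x = 0" if "x \<in> S" for x
      using \<phi>(2)[of x] \<phi>(2)[of "- x"] that subspace_neg[OF S(1) that] by (simp add: neg)
    show "\<phi> v \<noteq> 0"
      using \<phi>(3) infdist_pos_not_in_closed[OF S(2) _ v] subspace_0[OF S(1)] by fastforce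
  qed
qed

section \<open>Duality for Lipschitz-free spaces\<close>

lemma lip0_diff_le: "\<bar>lip0_apply f x - lip0_apply f y\<bar> \<le> norm f * dist x y"
  using lipschitz_onD[OF norm_lip0_lipschitz[of f], of x y] by (simp add: dist_real_def)

lemma lip0_abs_le: "\<bar>lip0_apply f x\<bar> \<le> norm f * dist x 0"
  using lip0_diff_le[of f x 0] by simp

lemma lip0_exists:
  assumes "f 0 = 0" "C-lipschitz_on UNIV f"
  obtains g where "lip0_apply g = f" "norm g \<le> C"
proof
  show g: "lip0_apply (Abs_lip0 f) = f"
    using assms by (intro Abs_lip0_inverse) auto
  show "norm (Abs_lip0 f) \<le> C"
    using assms by (intro norm_lip0_le) (simp add: g)
qed

lemma delta_apply [simp]: "blinfun_apply (delta x) f = lip0_apply f x"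
  by (simp add: delta.rep_eq)

lemma delta_0 [simp]: "delta 0 = 0"
  by (rule blinfun_eqI) simp

lemma norm_delta_diff_le: "norm (delta x - delta y) \<le> dist x y"
  by (rule norm_blinfun_bound)
    (use lip0_diff_le in \<open>auto simp: blinfun.diff_left mult.commute\<close>)

lemma subspace_closure:
  fixes S :: "'b::real_normed_vector set"
  assumes "subspace S"
  shows "subspace (closure S)"
proof (rule subspaceI)
  show "0 \<in> closure S" using subspace_0[OF assms] closure_subset by blast
  fix x y c assume "x \<in> closure S"
  then obtain a where a: "\<And>n. a n \<in> S" "a \<longlonglongrightarrow> x" by (auto simp: closure_sequential)
  show "c *\<^sub>R x \<in> closure S"
    unfolding closure_sequential
    by (rule exI[of _ "\<lambda>n. c *\<^sub>R a n"]) (auto intro!: tendsto_intros subspace_scale assms a)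
  assume "y \<in> closure S"
  then obtain b where b: "\<And>n. b n \<in> S" "b \<longlonglongrightarrow> y" by (auto simp: closure_sequential)
  show "x + y \<in> closure S"
    unfolding closure_sequential
    by (rule exI[of _ "\<lambda>n. a n + b n"]) (auto intro!: tendsto_intros subspace_add assms a b)
qed

lemma subspace_lip_free: "subspace (lip_free N)"
  unfolding lip_free_def by (intro subspace_closure subspace_span)

lemma closed_lip_free: "closed (lip_free N)"
  unfolding lip_free_def by simp

lemma lip_free_mono: "N \<subseteq> N' \<Longrightarrow> lip_free N \<subseteq> lip_free N'"
  unfolding lip_free_def by (intro closure_mono span_mono image_mono)

lemma span_delta_subset_lip_free: "span (delta ` N) \<subseteq> lip_free N"
  unfolding lip_free_def by (rule closure_subset)

lemma delta_in_lip_free: "x \<in> insert 0 N \<Longrightarrow> delta x \<in> lip_free N"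
  using span_delta_subset_lip_free[of N] subspace_0[OF subspace_lip_free[of N]]
  by (auto intro: span_base)

lemma lip_free_approx:
  assumes "\<mu> \<in> lip_free N" "0 < e"
  obtains \<nu> where "\<nu> \<in> span (delta ` N)" "norm (\<mu> - \<nu>) < e"
  using assms unfolding lip_free_def closure_approachable
  by (metis dist_norm dist_commute)

lemma lipschitz_extension:
  fixes f :: "'a::metric_space \<Rightarrow> real"
  assumes f: "L-lipschitz_on A f"
  obtains g where "L-lipschitz_on UNIV g" "\<And>x. x \<in> A \<Longrightarrow> g x = f x"
proof (cases "A = {}")
  case True
  with lipschitz_on_nonneg[OF f] show thesis
    by (intro that[of "\<lambda>_. 0"]) (auto simp: lipschitz_on_def)
next
  case False
  note L = lipschitz_on_nonneg[OF f]
  \<comment> \<open>McShane's formula, the largest \<open>L\<close>-Lipschitz function that lies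
    below \<open>f\<close> on \<open>A\<close>.\<close>
  define g where "g x = (INF a\<in>A. f a + L * dist x a)" for x
  have fD: "f a \<le> f b + L * dist a b" if "a \<in> A" "b \<in> A" for a b
    using lipschitz_onD[OF f that] by (simp add: dist_real_def)
  have low: "g x \<le> f a + L * dist x a" if "a \<in> A" for x a
    unfolding g_def
  proof (rule cINF_lower[OF _ that])
    show "bdd_below ((\<lambda>a. f a + L * dist x a) ` A)"
    proof (rule bdd_belowI2)
      fix b assume "b \<in> A"
      moreover have "L * dist a b \<le> L * (dist x a + dist x b)"
        by (intro mult_left_mono dist_triangle3 L)
      ultimately show "f a - L * dist x a \<le> f b + L * dist x b"
        using fD[OF that, of b] by (simp add: algebra_simps)
    qed
  qed
  have great: "c \<le> g x" if "\<And>a. a \<in> A \<Longrightarrow> c \<le> f a + L * dist x a" for c x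
    unfolding g_def using False that by (rule cINF_greatest)
  have *: "g x \<le> g y + L * dist x y" for x y
  proof -
    have "g x - L * dist x y \<le> g y"
    proof (rule great)
      fix a assume "a \<in> A"
      moreover have "L * dist x a \<le> L * (dist x y + dist y a)"
        by (intro mult_left_mono dist_triangle L)
      ultimately show "g x - L * dist x y \<le> f a + L * dist y a"
        using low[of a x] by (simp add: algebra_simps)
    qed
    then show ?thesis by simp
  qed
  show thesis
  proof (rule that[of g])
    show "L-lipschitz_on UNIV g"
    proof (rule lipschitz_onI[OF _ L])
      show "dist (g x) (g y) \<le> L * dist x y" for x y
        using *[of x y] *[of y x] by (simp add: dist_real_def abs_le_iff dist_commute)
    qed
    show "g x = f x" if "x \<in> A" for x
      using low[OF that, of x] fD[OF that] by (intro antisym great) auto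
  qed
qed

section \<open>Functionals on the free space as Lipschitz functions\<close>

lemma blinfun_apply_in_dual_on: "(\<lambda>\<mu>. blinfun_apply \<mu> f) \<in> dual_on X"
  unfolding dual_on_def
proof (intro CollectI conjI ballI allI exI[of _ "norm f"])
  show "\<bar>blinfun_apply \<mu> f\<bar> \<le> norm f * norm \<mu>" for \<mu> :: "'a \<Rightarrow>\<^sub>L real"
    using norm_blinfun[of \<mu> f] by (simp add: mult.commute)
qed (simp_all add: blinfun.bilinear_simps)

lemma dual_on_diff:
  assumes "\<phi> \<in> dual_on X" "subspace X" "x \<in> X" "y \<in> X"
  shows "\<phi> (x - y) = \<phi> x - \<phi> y"
proof -
  have "(-1) *\<^sub>R y \<in> X" using assms by (intro subspace_scale)
  then have "\<phi> (x + (-1) *\<^sub>R y) = \<phi> x + \<phi> ((-1) *\<^sub>R y)"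
    using assms unfolding dual_on_def by blast
  also have "\<phi> ((-1) *\<^sub>R y) = (-1) * \<phi> y"
    using assms unfolding dual_on_def by blast
  finally show ?thesis by simp
qed

text \<open>As \<open>delta\<close> is 1-Lipschitz, a bounded functional composed with it is
  Lipschitz and extends to all of M. The extension represents the functional on the span, then by
  continuity on the closure. It lives on M for every \<open>N\<close>, so all subspaces share the
  same test functions.\<close>

lemma dual_on_lip_free_representation:
  fixes N :: "'a::{metric_space,zero} set"
  assumes \<phi>: "\<phi> \<in> dual_on (lip_free N)"
  obtains f :: "'a lip0"
    where "\<And>\<mu>. \<mu> \<in> lip_free N \<Longrightarrow> \<phi> \<mu> = blinfun_apply \<mu> f"
proof -
  let ?X = "lip_free N"
  obtain B where "\<And>\<mu>. \<mu> \<in> ?X \<Longrightarrow> \<bar>\<phi> \<mu>\<bar> \<le> B * norm \<mu>"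
    using \<phi> unfolding dual_on_def by blast
  \<comment> \<open>A Lipschitz constant must be nonnegative, while \<open>dual_on\<close> admits
    any real bound.\<close>
  then have B: "\<bar>\<phi> \<mu>\<bar> \<le> \<bar>B\<bar> * norm \<mu>" if "\<mu> \<in> ?X" for \<mu>
    using that by (meson abs_ge_self mult_right_mono norm_ge_zero order_trans)
  have diff: "\<phi> (\<mu> - \<nu>) = \<phi> \<mu> - \<phi> \<nu>" if "\<mu> \<in> ?X" "\<nu> \<in> ?X" for \<mu> \<nu>
    using dual_on_diff[OF \<phi> subspace_lip_free that] .
  \<comment> \<open>The base point is added so that the extension vanishes there and gives an
    element of \<open>lip0\<close>.\<close>
  have "\<bar>B\<bar>-lipschitz_on (insert 0 N) (\<lambda>x. \<phi> (delta x))"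
  proof (rule lipschitz_onI)
    fix x y assume xy: "x \<in> insert 0 N" "y \<in> insert 0 N"
    then have "\<bar>\<phi> (delta x) - \<phi> (delta y)\<bar> \<le> \<bar>B\<bar> * norm (delta x - delta y)"
      using B[of "delta x - delta y"]
      by (simp add: diff delta_in_lip_free subspace_diff[OF subspace_lip_free])
    also have "\<dots> \<le> \<bar>B\<bar> * dist x y"
      by (intro mult_left_mono norm_delta_diff_le) simp
    finally show "dist (\<phi> (delta x)) (\<phi> (delta y)) \<le> \<bar>B\<bar> * dist x y"
      by (simp add: dist_real_def)
  qed simp
  then obtain g where g: "\<bar>B\<bar>-lipschitz_on UNIV g"
    "\<And>x. x \<in> insert 0 N \<Longrightarrow> g x = \<phi> (delta x)"
    by (rule lipschitz_extension) blast
  have "\<phi> 0 = 0" using B[of 0] subspace_0[OF subspace_lip_free[of N]] by simp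
  with g(2)[of 0] have "g 0 = 0" by simp
  then obtain f where f: "lip0_apply f = g" using g(1) by (rule lip0_exists)
  have span: "\<nu> \<in> ?X \<and> \<phi> \<nu> = blinfun_apply \<nu> f" if "\<nu> \<in> span (delta ` N)" for \<nu>
    using that
  proof (induction rule: span_induct_alt)
    case base
    show ?case using \<open>\<phi> 0 = 0\<close> subspace_0[OF subspace_lip_free] by simp
  next
    case (step c x y)
    then have x: "x \<in> ?X" and y: "y \<in> ?X" using delta_in_lip_free by auto
    from x have cx: "c *\<^sub>R x \<in> ?X" by (intro subspace_scale subspace_lip_free)
    from x y cx have "\<phi> (c *\<^sub>R x + y) = c * \<phi> x + \<phi> y"
      using \<phi> unfolding dual_on_def by fastforce
    moreover have "\<phi> x = blinfun_apply x f" using step(1) g(2) f by auto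
    ultimately show ?case
      using step cx y subspace_add[OF subspace_lip_free cx y]
      by (simp add: blinfun.bilinear_simps)
  qed
  show thesis
  proof (rule that[of f])
    fix \<mu> assume \<mu>: "\<mu> \<in> ?X"
    then obtain v where v: "\<And>n. v n \<in> span (delta ` N)" "v \<longlonglongrightarrow> \<mu>"
      unfolding lip_free_def by (auto simp: closure_sequential)
    have "(\<lambda>n. \<phi> (v n)) \<longlonglongrightarrow> \<phi> \<mu>"
    proof (rule LIM_zero_cancel, rule Lim_null_comparison)
      have "v n \<in> ?X" for n using v(1) span_delta_subset_lip_free by blast
      then show "\<forall>\<^sub>F n in sequentially. norm (\<phi> (v n) - \<phi> \<mu>) \<le> \<bar>B\<bar> * norm (v n - \<mu>)"
        using B[of "v n - \<mu>" for n] \<mu>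
        by (simp add: diff subspace_diff[OF subspace_lip_free])
      show "(\<lambda>n. \<bar>B\<bar> * norm (v n - \<mu>)) \<longlonglongrightarrow> 0"
        using v(2) by (intro tendsto_mult_right_zero tendsto_norm_zero LIM_zero)
    qed
    moreover have "(\<lambda>n. \<phi> (v n)) \<longlonglongrightarrow> blinfun_apply \<mu> f"
      unfolding span[OF v(1), THEN conjunct2] by (intro blinfun.tendsto v tendsto_const)
    ultimately show "\<phi> \<mu> = blinfun_apply \<mu> f" by (rule LIMSEQ_unique)
  qed
qed

lemma weakly_sequentially_complete_lip_free_iff:
  fixes N :: "'a::{metric_space,zero} set"
  shows "weakly_sequentially_complete (lip_free N) \<longleftrightarrow>
    (\<forall>u. range u \<subseteq> lip_free N \<longrightarrow> (\<forall>f. convergent (\<lambda>n. blinfun_apply (u n) f)) \<longrightarrow>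
      (\<exists>\<mu>\<in>lip_free N. \<forall>f. (\<lambda>n. blinfun_apply (u n) f) \<longlonglongrightarrow> blinfun_apply \<mu> f))"
proof -
  \<comment> \<open>The predicate \<open>P\<close> is kept general to cover both Cauchy sequences
    and limits; for the former, \<open>u 0\<close> merely fills the place of the limit.\<close>
  have *: "(\<forall>\<phi>\<in>dual_on (lip_free N). P (\<lambda>n. \<phi> (u n)) (\<phi> \<mu>)) \<longleftrightarrow>
      (\<forall>f. P (\<lambda>n. blinfun_apply (u n) f) (blinfun_apply \<mu> f))"
    if "range u \<subseteq> lip_free N" "\<mu> \<in> lip_free N"
    for u :: "nat \<Rightarrow> _" and \<mu> and P :: "(nat \<Rightarrow> real) \<Rightarrow> real \<Rightarrow> bool"
  proof safe
    fix f assume "\<forall>\<phi>\<in>dual_on (lip_free N). P (\<lambda>n. \<phi> (u n)) (\<phi> \<mu>)"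
    then show "P (\<lambda>n. blinfun_apply (u n) f) (blinfun_apply \<mu> f)"
      using blinfun_apply_in_dual_on by fast
  next
    fix \<phi> assume H: "\<forall>f. P (\<lambda>n. blinfun_apply (u n) f) (blinfun_apply \<mu> f)"
      and "\<phi> \<in> dual_on (lip_free N)"
    then obtain f where f: "\<And>\<mu>. \<mu> \<in> lip_free N \<Longrightarrow> \<phi> \<mu> = blinfun_apply \<mu> f"
      using dual_on_lip_free_representation by blast
    then have "\<phi> (u n) = blinfun_apply (u n) f" for n using that by auto
    with H f[OF that(2)] show "P (\<lambda>n. \<phi> (u n)) (\<phi> \<mu>)" by simp
  qed
  have "weakly_Cauchy_in (lip_free N) u \<longleftrightarrow>
      range u \<subseteq> lip_free N \<and> (\<forall>f. convergent (\<lambda>n. blinfun_apply (u n) f))" for u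
    using *[of u "u 0" "\<lambda>a b. convergent a"] unfolding weakly_Cauchy_in_def by auto
  moreover have "weakly_convergent_in (lip_free N) u \<longleftrightarrow> range u \<subseteq> lip_free N \<and>
      (\<exists>\<mu>\<in>lip_free N. \<forall>f. (\<lambda>n. blinfun_apply (u n) f) \<longlonglongrightarrow> blinfun_apply \<mu> f)" for u
    using *[of u _ "\<lambda>a b. a \<longlonglongrightarrow> b"] unfolding weakly_convergent_in_def
    by (intro conj_cong refl bex_cong) blast+
  ultimately show ?thesis
    unfolding weakly_sequentially_complete_def by auto
qed

section \<open>Supports, and continuity along bounded pointwise limits\<close>

lemma lip_free_annihilator:
  assumes \<mu>: "\<mu> \<in> lip_free UNIV"
    and zero: "\<And>f. (\<And>x. x \<in> K \<Longrightarrow> lip0_apply f x = 0) \<Longrightarrow> blinfun_apply \<mu> f = 0"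
  shows "\<mu> \<in> lip_free K"
proof (rule ccontr)
  \<comment> \<open>The separating functional is evaluation at some \<open>f\<close>, and
    \<open>f\<close> vanishes on \<open>K\<close> because \<open>delta x\<close> lies in
    \<open>lip_free K\<close> for \<open>x\<close> in \<open>K\<close>.\<close>
  assume "\<mu> \<notin> lip_free K"
  then obtain \<phi> :: "_ \<Rightarrow> real" where \<phi>: "linear \<phi>" "\<And>x. \<bar>\<phi> x\<bar> \<le> norm x"
    "\<And>x. x \<in> lip_free K \<Longrightarrow> \<phi> x = 0" "\<phi> \<mu> \<noteq> 0"
    using separating_functional[OF subspace_lip_free closed_lip_free] by metis
  have "\<phi> \<in> dual_on (lip_free UNIV)"
    unfolding dual_on_def using \<phi>(2)
    by (auto simp: linear_add[OF \<phi>(1)] linear_scale[OF \<phi>(1)] intro: exI[of _ 1])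
  then obtain f where f: "\<And>\<mu>. \<mu> \<in> lip_free UNIV \<Longrightarrow> \<phi> \<mu> = blinfun_apply \<mu> f"
    using dual_on_lip_free_representation by blast
  have "lip0_apply f x = 0" if "x \<in> K" for x
    using f[of "delta x"] \<phi>(3)[of "delta x"] that by (simp add: delta_in_lip_free)
  then have "blinfun_apply \<mu> f = 0" by (rule zero)
  with f[OF \<mu>] \<phi>(4) show False by simp
qed

lemma lip_free_vanish:
  assumes \<mu>: "\<mu> \<in> lip_free K" and f: "\<And>x. x \<in> K \<Longrightarrow> lip0_apply f x = 0"
  shows "blinfun_apply \<mu> f = 0"
proof -
  have span: "blinfun_apply \<nu> f = 0" if "\<nu> \<in> span (delta ` K)" for \<nu>
    using that by (induction rule: span_induct_alt) (auto simp: blinfun.bilinear_simps f)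
  from \<mu> obtain v where v: "\<And>n. v n \<in> span (delta ` K)" "v \<longlonglongrightarrow> \<mu>"
    unfolding lip_free_def by (auto simp: closure_sequential)
  have "(\<lambda>n. blinfun_apply (v n) f) \<longlonglongrightarrow> blinfun_apply \<mu> f"
    by (intro blinfun.tendsto v tendsto_const)
  then show ?thesis by (simp add: span[OF v(1)] LIMSEQ_const_iff)
qed

text \<open>An element of the span sees only finitely many points; what remains of
  \<open>\<mu>\<close> has norm below \<open>e\<close>.\<close>

lemma lip_free_finite_carrier:
  fixes \<mu> :: "'a::{metric_space,zero} lip0 \<Rightarrow>\<^sub>L real"
  assumes "\<mu> \<in> lip_free UNIV" "0 < e"
  obtains E where "finite E"
    "\<And>f. (\<And>x. x \<in> E \<Longrightarrow> lip0_apply f x = 0) \<Longrightarrow> \<bar>blinfun_apply \<mu> f\<bar> \<le> e * norm f"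
proof -
  obtain \<nu> where \<nu>: "\<nu> \<in> span (range delta)" "norm (\<mu> - \<nu>) < e"
    using lip_free_approx[OF assms] by blast
  from \<nu>(1) have "\<exists>E. finite E \<and>
    (\<forall>f. (\<forall>x\<in>E. lip0_apply f x = 0) \<longrightarrow> blinfun_apply \<nu> f = 0)"
  proof (induction rule: span_induct_alt)
    case base
    show ?case by (rule exI[of _ "{}"]) simp
  next
    case (step c \<mu> \<nu>)
    from step(1) obtain x where "\<mu> = delta x" by blast
    moreover from step(2) obtain E where "finite E"
      "\<forall>f. (\<forall>x\<in>E. lip0_apply f x = 0) \<longrightarrow> blinfun_apply \<nu> f = 0" by blast
    ultimately show ?case
      by (intro exI[of _ "insert x E"]) (simp add: blinfun.bilinear_simps)
  qed
  then obtain E where E: "finite E"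
    "\<forall>f. (\<forall>x\<in>E. lip0_apply f x = 0) \<longrightarrow> blinfun_apply \<nu> f = 0" by blast
  show thesis
  proof (rule that[OF E(1)])
    fix f :: "'a lip0" assume "\<And>x. x \<in> E \<Longrightarrow> lip0_apply f x = 0"
    then have "blinfun_apply \<mu> f = blinfun_apply (\<mu> - \<nu>) f"
      using E(2) by (simp add: blinfun.diff_left)
    also have "\<bar>\<dots>\<bar> \<le> norm (\<mu> - \<nu>) * norm f" using norm_blinfun[of "\<mu> - \<nu>" f] by simp
    also have "\<dots> \<le> e * norm f" using \<nu>(2) by (intro mult_right_mono) auto
    finally show "\<bar>blinfun_apply \<mu> f\<bar> \<le> e * norm f" .
  qed
qed

text \<open>Clear for finite combinations of evaluations; the bound \<open>B\<close> makes the error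
  of approximating \<open>\<mu>\<close> by them uniform in \<open>k\<close>.\<close>

lemma lip_free_bounded_pointwise_tendsto_zero:
  assumes \<mu>: "\<mu> \<in> lip_free UNIV"
    and bound: "\<And>k::nat. norm (g k) \<le> B"
    and lim: "\<And>x. (\<lambda>k. lip0_apply (g k) x) \<longlonglongrightarrow> 0"
  shows "(\<lambda>k. blinfun_apply \<mu> (g k)) \<longlonglongrightarrow> 0"
proof -
  have "\<forall>\<^sub>F k in sequentially. \<bar>blinfun_apply \<mu> (g k)\<bar> < e" if e: "0 < e" for e
  proof -
    have "0 \<le> B" using bound[of 0] norm_ge_zero order_trans by blast
    \<comment> \<open>The summand 1 keeps the denominator positive when \<open>B\<close> is
      0.\<close>
    then have "0 < e / (2 * (B + 1))" using e by simp
    then obtain \<nu> where \<nu>: "\<nu> \<in> span (range delta)" "norm (\<mu> - \<nu>) < e / (2 * (B + 1))"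
      using lip_free_approx[OF \<mu>] by blast
    from \<nu>(1) have "(\<lambda>k. blinfun_apply \<nu> (g k)) \<longlonglongrightarrow> 0"
    proof (induction rule: span_induct_alt)
      case (step c x y)
      then have "(\<lambda>k. c * blinfun_apply x (g k) + blinfun_apply y (g k)) \<longlonglongrightarrow> c * 0 + 0"
        using lim by (intro tendsto_intros) auto
      then show ?case by (simp add: blinfun.bilinear_simps)
    qed simp
    then have "\<forall>\<^sub>F k in sequentially. \<bar>blinfun_apply \<nu> (g k)\<bar> < e / 2"
      using e by (auto simp: tendsto_iff dest: spec[of _ "e / 2"])
    then show ?thesis
    proof eventually_elim
      case (elim k)
      have "\<bar>blinfun_apply (\<mu> - \<nu>) (g k)\<bar> \<le> norm (\<mu> - \<nu>) * norm (g k)"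
        using norm_blinfun[of "\<mu> - \<nu>" "g k"] by simp
      also have "\<dots> \<le> e / (2 * (B + 1)) * B"
        using \<nu>(2) bound[of k] \<open>0 \<le> B\<close> e by (intro mult_mono) auto
      also have "\<dots> \<le> e / 2" using \<open>0 \<le> B\<close> e by (simp add: field_simps)
      finally show ?case using elim unfolding blinfun.diff_left by linarith
    qed
  qed
  then show ?thesis by (simp add: tendsto_iff)
qed

section \<open>Cutoffs and the gliding hump\<close>

text \<open>
  The width of the neighbourhood \<open>near c E\<close> is proportional to the distance from the base point.
  Since \<open>\<bar>f x\<bar> \<le> norm f * dist x 0\<close>, this makes the norm of multiplication by the corresponding
  cutoff weight depend on \<open>c\<close> only, so that no separate reduction to bounded spaces is needed.
\<close>

definition near :: "real \<Rightarrow> 'a::{metric_space,zero} set \<Rightarrow> 'a set"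
  where "near c E = {x. c * infdist x (insert 0 E) \<le> dist x 0}"

text \<open>At the base point \<open>rel_infdist\<close> takes the junk value \<open>0 / 0 = 0\<close>, which is the right one.\<close>

definition rel_infdist :: "'a::{metric_space,zero} set \<Rightarrow> 'a \<Rightarrow> real"
  where "rel_infdist E x = infdist x (insert 0 E) / dist x 0"

text \<open>A trapezoid in the relative distance: 1 on \<open>near c E\<close>, 0 outside
  \<open>near (c / 2) E\<close>, and linear in \<open>rel_infdist E x\<close> in between.\<close>

definition cutoff_weight :: "real \<Rightarrow> 'a::{metric_space,zero} set \<Rightarrow> 'a \<Rightarrow> real"
  where "cutoff_weight c E x = max 0 (min 1 (2 - c * rel_infdist E x))"

lemma infdist_insert_0_le: "infdist x (insert 0 E) \<le> dist x 0"
  by (rule infdist_le) simp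

lemma rel_infdist_mult: "rel_infdist E x * dist x 0 = infdist x (insert 0 E)"
  using infdist_insert_0_le[of x E] infdist_nonneg[of x "insert 0 E"]
  by (auto simp: rel_infdist_def)

lemma rel_infdist_nonneg: "0 \<le> rel_infdist E x"
  by (simp add: rel_infdist_def infdist_nonneg)

lemma rel_infdist_le_1: "rel_infdist E x \<le> 1"
  using infdist_insert_0_le[of x E] by (simp add: rel_infdist_def divide_le_eq)

lemma near_mono:
  assumes "0 \<le> c" "E \<subseteq> E'"
  shows "near c E \<subseteq> near c E'"
proof -
  have "c * infdist x (insert 0 E') \<le> c * infdist x (insert 0 E)" for x
    using assms by (intro mult_left_mono infdist_mono) auto
  then show ?thesis by (auto simp: near_def intro: order_trans)
qed

lemma subset_near: "insert 0 E \<subseteq> near c E"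
  by (auto simp: near_def)

lemma closed_near: "closed (near c E)"
  unfolding near_def by (intro closed_Collect_le continuous_intros)

lemma cutoff_weight_bounds: "0 \<le> cutoff_weight c E x" "cutoff_weight c E x \<le> 1"
  by (auto simp: cutoff_weight_def)

lemma cutoff_weight_near: "x \<in> near c E \<Longrightarrow> cutoff_weight c E x = 1"
  by (cases "x = 0") (auto simp: near_def cutoff_weight_def rel_infdist_def divide_le_eq)

lemma cutoff_weight_not_near: "x \<notin> near (c / 2) E \<Longrightarrow> cutoff_weight c E x = 0"
proof -
  assume "x \<notin> near (c / 2) E"
  then have *: "2 * dist x 0 < c * infdist x (insert 0 E)" by (simp add: near_def)
  then have "x \<noteq> 0" by auto
  with * have "2 < c * rel_infdist E x" by (simp add: rel_infdist_def less_divide_eq)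
  then show ?thesis by (simp add: cutoff_weight_def)
qed

text \<open>Near the base point the weight alone need not be Lipschitz; the factor
  \<open>dist x 0\<close>, later supplied by the bound on \<open>f x\<close>, repairs this. In the
  quotient \<open>rel_infdist\<close>, numerator and denominator contribute one
  \<open>dist x y\<close> each, the latter because the quotient is at most 1.\<close>

lemma cutoff_weight_diff:
  "\<bar>cutoff_weight c E x - cutoff_weight c E y\<bar> * dist x 0 \<le> 2 * \<bar>c\<bar> * dist x y"
proof -
  let ?q = "rel_infdist E" and ?s = "\<lambda>x. infdist x (insert 0 E)"
  have "(?q x - ?q y) * dist x 0 = (?s x - ?s y) + ?q y * (dist y 0 - dist x 0)"
    using rel_infdist_mult[of E x] rel_infdist_mult[of E y] by (simp add: algebra_simps)
  then have "\<bar>(?q x - ?q y) * dist x 0\<bar> \<le> \<bar>?s x - ?s y\<bar> + ?q y * \<bar>dist y 0 - dist x 0\<bar>"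
    using rel_infdist_nonneg[of E y] by (metis abs_mult abs_of_nonneg abs_triangle_ineq)
  also have "\<dots> \<le> dist x y + 1 * dist x y"
    using infdist_triangle_abs[of x "insert 0 E" y] abs_dist_diff_le[of y 0 x]
    by (intro add_mono mult_mono rel_infdist_le_1) (auto simp: dist_commute)
  finally have q: "\<bar>?q x - ?q y\<bar> * dist x 0 \<le> 2 * dist x y" by (simp add: abs_mult)
  have "\<bar>cutoff_weight c E x - cutoff_weight c E y\<bar> \<le> \<bar>c * ?q x - c * ?q y\<bar>"
    unfolding cutoff_weight_def by linarith
  also have "\<dots> = \<bar>c\<bar> * \<bar>?q x - ?q y\<bar>" by (simp add: abs_mult flip: right_diff_distrib)
  finally have "\<bar>cutoff_weight c E x - cutoff_weight c E y\<bar> * dist x 0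
      \<le> \<bar>c\<bar> * \<bar>?q x - ?q y\<bar> * dist x 0"
    by (rule mult_right_mono) simp
  also have "\<dots> \<le> \<bar>c\<bar> * (2 * dist x y)"
    using q by (simp add: mult.assoc mult_left_mono)
  finally show ?thesis by simp
qed

lemma lipschitz_on_cutoff:
  "((1 + 2 * \<bar>c\<bar>) * norm f)-lipschitz_on UNIV (\<lambda>x. lip0_apply f x * cutoff_weight c E x)"
proof (rule lipschitz_onI)
  let ?h = "cutoff_weight c E"
  fix x y
  \<comment> \<open>The difference of the weights is paired with the value of \<open>f\<close> at
    \<open>x\<close>, matching the factor \<open>dist x 0\<close> in
    \<open>cutoff_weight_diff\<close>.\<close>
  have "lip0_apply f x * ?h x - lip0_apply f y * ?h y =
      lip0_apply f x * (?h x - ?h y) + (lip0_apply f x - lip0_apply f y) * ?h y"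
    by (simp add: algebra_simps)
  also have "\<bar>\<dots>\<bar> \<le> \<bar>lip0_apply f x\<bar> * \<bar>?h x - ?h y\<bar> + \<bar>lip0_apply f x - lip0_apply f y\<bar> * \<bar>?h y\<bar>"
    by (metis abs_mult abs_triangle_ineq)
  also have "\<dots> \<le> norm f * dist x 0 * \<bar>?h x - ?h y\<bar> + norm f * dist x y * 1"
    using cutoff_weight_bounds[of c E y]
    by (intro add_mono mult_mono lip0_abs_le lip0_diff_le) auto
  also have "norm f * dist x 0 * \<bar>?h x - ?h y\<bar> \<le> norm f * (2 * \<bar>c\<bar> * dist x y)"
    using mult_left_mono[OF cutoff_weight_diff[of c E x y], of "norm f"] by (simp add: mult_ac)
  finally show "dist (lip0_apply f x * ?h x) (lip0_apply f y * ?h y)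
      \<le> (1 + 2 * \<bar>c\<bar>) * norm f * dist x y"
    by (simp add: dist_real_def algebra_simps)
qed simp

text \<open>Packaged as a bounded operator on \<open>lip0\<close> so that its adjoint is simply
  \<open>\<mu> o\<^sub>L cutoff c E\<close>.\<close>

lift_definition cutoff :: "real \<Rightarrow> 'a::{metric_space,zero} set \<Rightarrow> 'a lip0 \<Rightarrow>\<^sub>L 'a lip0"
  is "\<lambda>c E f. Abs_lip0 (\<lambda>x. lip0_apply f x * cutoff_weight c E x)"
proof -
  fix c :: real and E :: "'a set"
  define T where "T f = Abs_lip0 (\<lambda>x. lip0_apply f x * cutoff_weight c E x)" for f
  have app: "lip0_apply (T f) = (\<lambda>x. lip0_apply f x * cutoff_weight c E x)" for f
    unfolding T_def using lipschitz_on_cutoff by (intro Abs_lip0_inverse) auto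
  have "bounded_linear T"
  proof (rule bounded_linear_intro[where K = "1 + 2 * \<bar>c\<bar>"])
    show "T (f + g) = T f + T g" for f g
      by (rule lip0_eqI) (simp add: app plus_lip0.rep_eq algebra_simps)
    show "T (r *\<^sub>R f) = r *\<^sub>R T f" for r f
      by (rule lip0_eqI) (simp add: app scaleR_lip0.rep_eq)
    show "norm (T f) \<le> norm f * (1 + 2 * \<bar>c\<bar>)" for f
      using lipschitz_on_cutoff[of c f E] by (intro norm_lip0_le) (simp add: app mult.commute)
  qed
  then show "bounded_linear (\<lambda>f. Abs_lip0 (\<lambda>x. lip0_apply f x * cutoff_weight c E x))"
    by (simp add: T_def[abs_def])
qed

lemma cutoff_apply:
  "lip0_apply (blinfun_apply (cutoff c E) f) x = lip0_apply f x * cutoff_weight c E x"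
proof -
  have "lip0_apply (blinfun_apply (cutoff c E) f) =
      (\<lambda>x. lip0_apply f x * cutoff_weight c E x)"
    unfolding cutoff.rep_eq using lipschitz_on_cutoff by (intro Abs_lip0_inverse) auto
  then show ?thesis by simp
qed

lemma norm_cutoff_le: "norm (blinfun_apply (cutoff c E) f) \<le> (1 + 2 * \<bar>c\<bar>) * norm f"
  using lipschitz_on_cutoff by (intro norm_lip0_le) (simp add: cutoff_apply[abs_def])

section \<open>The gliding hump\<close>

lemma lipschitz_on_max:
  fixes f g :: "'a::metric_space \<Rightarrow> real"
  assumes "L-lipschitz_on A f" "L-lipschitz_on A g"
  shows "L-lipschitz_on A (\<lambda>x. max (f x) (g x))"
proof (rule lipschitz_onI)
  fix x y assume "x \<in> A" "y \<in> A"
  then show "dist (max (f x) (g x)) (max (f y) (g y)) \<le> L * dist x y"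
    using lipschitz_onD[OF assms(1), of x y] lipschitz_onD[OF assms(2), of x y]
    unfolding dist_real_def by linarith
qed (use assms lipschitz_on_nonneg in blast)

text \<open>
  A failing \<open>f\<close> vanishes near \<open>E\<close>, so its cutoff \<open>g\<close> to a larger \<open>E'\<close> is disjointly supported from
  \<open>S\<close>. As both are nonnegative, \<open>S + g\<close> is the maximum of \<open>S\<close> and \<open>g\<close>, and the Lipschitz constant
  does not grow.
\<close>

lemma gliding_hump_step:
  fixes u :: "nat \<Rightarrow> 'a::{metric_space,zero} lip0 \<Rightarrow>\<^sub>L real"
  assumes u: "\<And>n. u n \<in> lip_free UNIV"
    and conv: "\<And>f. convergent (\<lambda>n. blinfun_apply (u n) f)"
    and c: "0 \<le> c" and e: "0 < e"
    and fail: "\<And>E. finite E \<Longrightarrow> \<exists>n f. norm f \<le> 1 \<and> (\<forall>x. 0 \<le> lip0_apply f x) \<and>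
      (\<forall>x\<in>near c E. lip0_apply f x = 0) \<and> e < \<bar>blinfun_apply (u n) f\<bar>"
    and E: "finite E" and S: "norm S \<le> 1 + 4 * c" "\<And>x. 0 \<le> lip0_apply S x"
      "\<And>x. x \<notin> near c E \<Longrightarrow> lip0_apply S x = 0"
  obtains E' S' m n where "finite E'" "E \<subseteq> E'"
    "norm S' \<le> 1 + 4 * c" "\<And>x. 0 \<le> lip0_apply S' x"
    "\<And>x. x \<notin> near c E' \<Longrightarrow> lip0_apply S' x = 0"
    "\<And>x. x \<in> near c E \<Longrightarrow> lip0_apply S' x = lip0_apply S x" "k \<le> m" "k \<le> n"
    "\<And>g. norm g \<le> 1 + 4 * c \<Longrightarrow> (\<And>x. x \<in> E' \<Longrightarrow> lip0_apply g x = lip0_apply S' x) \<Longrightarrow>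
      e / 2 \<le> \<bar>blinfun_apply (u n) g - blinfun_apply (u m) g\<bar>"
proof -
  define C where "C = 1 + 4 * c"
  \<comment> \<open>Sized for the final estimate: one error \<open>\<eta>\<close> and two errors
    \<open>\<eta> * (2 * C + 1)\<close> add up to at most e / 4.\<close>
  define \<eta> where "\<eta> = e / (16 * (1 + C))"
  have C: "0 \<le> C" "0 < 1 + C" using c by (auto simp: C_def)
  then have "16 + 16 * C \<noteq> 0" by linarith
  with C e have \<eta>: "0 < \<eta>" "\<eta> * (4 * (1 + C)) = e / 4"
    by (simp_all add: \<eta>_def field_simps)
  have "\<eta> * 1 \<le> \<eta> * (4 * (1 + C))" using \<eta>(1) C by (intro mult_left_mono) auto
  then have "\<eta> < e" using \<eta>(2) e by linarith
  have "\<exists>F. finite F \<and> (\<forall>f. (\<forall>x\<in>F. lip0_apply f x = 0) \<longrightarrow>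
      \<bar>blinfun_apply (u i) f\<bar> \<le> \<eta> * norm f)" for i
    using lip_free_finite_carrier[OF u \<eta>(1)] by metis
  then obtain F where F: "\<And>i. finite (F i)"
    "\<And>i f. (\<And>x. x \<in> F i \<Longrightarrow> lip0_apply f x = 0) \<Longrightarrow> \<bar>blinfun_apply (u i) f\<bar> \<le> \<eta> * norm f"
    by metis
  have "Cauchy (\<lambda>n. blinfun_apply (u n) S)" using conv Cauchy_convergent_iff by blast
  then obtain m0 where m0: "\<And>p q. p \<ge> m0 \<Longrightarrow> q \<ge> m0 \<Longrightarrow>
      \<bar>blinfun_apply (u p) S - blinfun_apply (u q) S\<bar> < e / 8"
    using e unfolding Cauchy_def dist_real_def by (metis divide_pos_pos zero_less_numeral)
  define m where "m = max k m0"
  \<comment> \<open>\<open>E1\<close> contains the carriers of all \<open>u i\<close> with i \<le>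
    m, so a function vanishing near it is almost invisible to them. The index \<open>n\<close> at
    which it is visible must then exceed \<open>m\<close>.\<close>
  define E1 where "E1 = E \<union> (\<Union>i\<le>m. F i)"
  have "finite E1" using E F(1) by (simp add: E1_def)
  then obtain n f where f: "norm f \<le> 1" "\<And>x. 0 \<le> lip0_apply f x"
    "\<And>x. x \<in> near c E1 \<Longrightarrow> lip0_apply f x = 0" "e < \<bar>blinfun_apply (u n) f\<bar>"
    using fail[OF \<open>finite E1\<close>] by blast
  have small: "\<bar>blinfun_apply (u i) f\<bar> \<le> \<eta>" if "i \<le> m" for i
  proof -
    have "F i \<subseteq> near c E1" using subset_near[of E1 c] that by (auto simp: E1_def)
    then have "\<bar>blinfun_apply (u i) f\<bar> \<le> \<eta> * norm f" using f(3) by (intro F(2)) auto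
    also have "\<dots> \<le> \<eta> * 1" using f(1) \<eta>(1) by (intro mult_left_mono) auto
    finally show ?thesis by simp
  qed
  then have "m < n" using small[of n] f(4) \<open>\<eta> < e\<close> by linarith
  \<comment> \<open>With the carrier of \<open>u n\<close> included, values on \<open>E2\<close>
    determine the pairings with both \<open>u m\<close> and \<open>u n\<close> up to small
    errors.\<close>
  define E2 where "E2 = E1 \<union> F n"
  have sub: "near c E \<subseteq> near c E1" "near c E1 \<subseteq> near c E2"
    by (auto simp: E1_def E2_def intro!: near_mono c del: subsetI)
  \<comment> \<open>Parameter \<open>2 * c\<close> makes the weight vanish outside
    \<open>near c E2\<close>, and is the origin of the constant 1 + 4c.\<close>
  define g where "g = blinfun_apply (cutoff (2 * c) E2) f"
  have "norm g \<le> (1 + 2 * \<bar>2 * c\<bar>) * norm f" unfolding g_def by (rule norm_cutoff_le)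
  also have "\<dots> \<le> C * 1" using c f(1) by (intro mult_mono) (auto simp: C_def)
  finally have "norm g \<le> C" by simp
  have g_apply: "lip0_apply g x = lip0_apply f x * cutoff_weight (2 * c) E2 x" for x
    by (simp add: g_def cutoff_apply)
  have g_nonneg: "0 \<le> lip0_apply g x" for x
    by (simp add: g_apply f(2) cutoff_weight_bounds)
  have g_off: "lip0_apply g x = 0" if "x \<notin> near c E2" for x
    using cutoff_weight_not_near[of x "2 * c" E2] that by (simp add: g_apply)
  have g_E1: "lip0_apply g x = 0" if "x \<in> near c E1" for x
    using f(3)[OF that] by (simp add: g_apply)
  have g_E2: "lip0_apply g x = lip0_apply f x" if "x \<in> E2" for x
    using cutoff_weight_near[of x "2 * c" E2] subset_near[of E2 "2 * c"] that
    by (auto simp: g_apply)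
  have "C-lipschitz_on UNIV (\<lambda>x. max (lip0_apply S x) (lip0_apply g x))"
    using S(1) \<open>norm g \<le> C\<close>
    by (intro lipschitz_on_max lipschitz_on_mono[OF norm_lip0_lipschitz]) (auto simp: C_def)
  then obtain S' where S': "lip0_apply S' = (\<lambda>x. max (lip0_apply S x) (lip0_apply g x))"
    "norm S' \<le> C"
    by (rule lip0_exists[rotated]) auto
  have sum: "max (lip0_apply S x) (lip0_apply g x) = lip0_apply S x + lip0_apply g x" for x
    using S(2)[of x] S(3)[of x] g_nonneg[of x] g_E1[of x] sub(1) by (cases "x \<in> near c E") auto
  show thesis
  proof (rule that[of E2 S' m n])
    show "finite E2" using \<open>finite E1\<close> F(1) by (simp add: E2_def)
    show "E \<subseteq> E2" by (auto simp: E2_def E1_def)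
    show "norm S' \<le> 1 + 4 * c" using S'(2) by (simp add: C_def)
    show "0 \<le> lip0_apply S' x" for x using S(2)[of x] by (auto simp: S'(1))
    show "lip0_apply S' x = 0" if "x \<notin> near c E2" for x
      using S(3)[of x] g_off[OF that] sub that by (auto simp: S'(1) sum)
    show "lip0_apply S' x = lip0_apply S x" if "x \<in> near c E" for x
      using g_E1[of x] that sub(1) by (auto simp: S'(1) sum)
    show "k \<le> m" "k \<le> n" using \<open>m < n\<close> by (auto simp: m_def)
    fix G assume G: "norm G \<le> 1 + 4 * c" "\<And>x. x \<in> E2 \<Longrightarrow> lip0_apply G x = lip0_apply S' x"
    \<comment> \<open>The lower bound is known for \<open>f\<close>, not for its cutoff
      \<open>g\<close>. Both agree on \<open>E2\<close>, so \<open>G\<close> may be compared with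
      \<open>S + f\<close>.\<close>
    define r where "r = G - S - f"
    have "norm r \<le> norm G + norm S + norm f"
      unfolding r_def by (rule order_trans[OF norm_triangle_ineq4 add_right_mono[OF norm_triangle_ineq4]])
    then have "norm r \<le> 2 * C + 1" using G(1) S(1) f(1) by (simp add: C_def)
    have "lip0_apply r x = 0" if "x \<in> E2" for x
      using G(2)[OF that] g_E2[OF that] by (simp add: r_def minus_lip0.rep_eq S'(1) sum)
    then have "\<bar>blinfun_apply (u i) r\<bar> \<le> \<eta> * norm r" if "i \<in> {m, n}" for i
      using that by (intro F(2)) (auto simp: E2_def E1_def)
    then have r: "\<bar>blinfun_apply (u i) r\<bar> \<le> \<eta> * (2 * C + 1)" if "i \<in> {m, n}" for i
      using that order_trans[OF _ mult_left_mono[OF \<open>norm r \<le> 2 * C + 1\<close> less_imp_le[OF \<eta>(1)]]]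
      by blast
    have G_split: "blinfun_apply (u i) G =
        blinfun_apply (u i) S + blinfun_apply (u i) f + blinfun_apply (u i) r" for i
      by (simp add: r_def blinfun.diff_right)
    have "\<bar>blinfun_apply (u n) S - blinfun_apply (u m) S\<bar> \<le> e / 8"
      using \<open>m < n\<close> by (intro less_imp_le[OF m0]) (auto simp: m_def)
    note bounds = this small[OF order_refl] r[of m, simplified] r[of n, simplified]
    \<comment> \<open>The jump is at least e - e/8 - e/4, where e/8 bounds the oscillation on
      \<open>S\<close>.\<close>
    have "\<eta> + \<eta> * (2 * C + 1) + \<eta> * (2 * C + 1) \<le> e / 4"
      using \<eta> by (simp add: algebra_simps)
    then show "e / 2 \<le> \<bar>blinfun_apply (u n) G - blinfun_apply (u m) G\<bar>"
      using bounds[THEN abs_le_D1] bounds[THEN abs_le_D2] f(4) e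
      unfolding G_split by linarith
  qed
qed

text \<open>Otherwise the step can be iterated forever. The functions stabilise on each
  \<open>near c (E k)\<close>, so their pointwise limit \<open>G\<close> agrees with
  \<open>S (Suc k)\<close> on \<open>E (Suc k)\<close>. It inherits a jump of size e / 2 beyond
  every index, and its pairings with \<open>u\<close> are not Cauchy.\<close>

lemma weakly_Cauchy_small_off_near_nonneg:
  fixes u :: "nat \<Rightarrow> 'a::{metric_space,zero} lip0 \<Rightarrow>\<^sub>L real"
  assumes u: "\<And>n. u n \<in> lip_free UNIV"
    and conv: "\<And>f. convergent (\<lambda>n. blinfun_apply (u n) f)"
    and c: "0 \<le> c" and e: "0 < e"
  obtains E where "finite E"
    "\<And>n f. norm f \<le> 1 \<Longrightarrow> (\<And>x. 0 \<le> lip0_apply f x) \<Longrightarrow>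
      (\<And>x. x \<in> near c E \<Longrightarrow> lip0_apply f x = 0) \<Longrightarrow> \<bar>blinfun_apply (u n) f\<bar> \<le> e"
proof (rule ccontr)
  note outer = that
  assume no: "\<not> thesis"
  have *: "\<not> (\<forall>n f. norm f \<le> 1 \<longrightarrow> (\<forall>x. 0 \<le> lip0_apply f x) \<longrightarrow>
      (\<forall>x\<in>near c E. lip0_apply f x = 0) \<longrightarrow> \<bar>blinfun_apply (u n) f\<bar> \<le> e)" if "finite E" for E
    using no outer[OF that] by blast
  have fail: "\<exists>n f. norm f \<le> 1 \<and> (\<forall>x. 0 \<le> lip0_apply f x) \<and>
      (\<forall>x\<in>near c E. lip0_apply f x = 0) \<and> e < \<bar>blinfun_apply (u n) f\<bar>"
    if "finite E" for E
    using that *[of E] by (meson not_le)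
  define P where "P k p \<longleftrightarrow> (case p of (S, E) \<Rightarrow> finite E \<and> norm S \<le> 1 + 4 * c \<and>
    (\<forall>x. 0 \<le> lip0_apply S x) \<and> (\<forall>x. x \<notin> near c E \<longrightarrow> lip0_apply S x = 0))"
    for k :: nat and p :: "'a lip0 \<times> 'a set"
  define Q where "Q k p p' \<longleftrightarrow> (case p of (S, E) \<Rightarrow> case p' of (S', E') \<Rightarrow> E \<subseteq> E' \<and>
    (\<forall>x\<in>near c E. lip0_apply S' x = lip0_apply S x) \<and>
    (\<exists>m\<ge>k. \<exists>n\<ge>k. \<forall>g. norm g \<le> 1 + 4 * c \<longrightarrow> (\<forall>x\<in>E'. lip0_apply g x = lip0_apply S' x) \<longrightarrow>
      e / 2 \<le> \<bar>blinfun_apply (u n) g - blinfun_apply (u m) g\<bar>))"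
    for k :: nat and p p' :: "'a lip0 \<times> 'a set"
  have "\<exists>p. \<forall>k. P k (p k) \<and> Q k (p k) (p (Suc k))"
  proof (rule dependent_nat_choice)
    show "\<exists>p. P 0 p"
      using c by (intro exI[of _ "(0, {})"]) (simp add: P_def zero_lip0.rep_eq)
    fix p k assume P: "P k p"
    obtain S E where p: "p = (S, E)" by (cases p)
    with P have SE: "finite E" "norm S \<le> 1 + 4 * c" "\<And>x. 0 \<le> lip0_apply S x"
      "\<And>x. x \<notin> near c E \<Longrightarrow> lip0_apply S x = 0" by (auto simp: P_def)
    show "\<exists>p'. P (Suc k) p' \<and> Q k p p'"
    proof (rule gliding_hump_step[OF u conv c e fail SE, of k])
      fix E' S' m n
      assume *: "finite E'" "E \<subseteq> E'"
        "norm S' \<le> 1 + 4 * c" "\<And>x. 0 \<le> lip0_apply S' x"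
        "\<And>x. x \<notin> near c E' \<Longrightarrow> lip0_apply S' x = 0"
        "\<And>x. x \<in> near c E \<Longrightarrow> lip0_apply S' x = lip0_apply S x" "k \<le> m" "k \<le> n"
        "\<And>g. norm g \<le> 1 + 4 * c \<Longrightarrow> (\<And>x. x \<in> E' \<Longrightarrow> lip0_apply g x = lip0_apply S' x) \<Longrightarrow>
          e / 2 \<le> \<bar>blinfun_apply (u n) g - blinfun_apply (u m) g\<bar>"
      have "\<exists>m\<ge>k. \<exists>n\<ge>k. \<forall>g. norm g \<le> 1 + 4 * c \<longrightarrow>
          (\<forall>x\<in>E'. lip0_apply g x = lip0_apply S' x) \<longrightarrow>
          e / 2 \<le> \<bar>blinfun_apply (u n) g - blinfun_apply (u m) g\<bar>"
        by (rule exI[of _ m], rule conjI[OF *(7)], rule exI[of _ n], rule conjI[OF *(8)])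
          (intro allI impI *(9); blast)
      then have "Q k p (S', E')"
        unfolding Q_def p prod.case using *(2,6) by blast
      moreover have "P (Suc k) (S', E')"
        unfolding P_def prod.case using *(1,3,4,5) by blast
      ultimately show ?thesis by blast
    qed
  qed
  then obtain p where p: "\<And>k. P k (p k)" "\<And>k. Q k (p k) (p (Suc k))" by blast
  define S where "S k = fst (p k)" for k
  define E where "E k = snd (p k)" for k
  have S: "norm (S k) \<le> 1 + 4 * c" "x \<notin> near c (E k) \<Longrightarrow> lip0_apply (S k) x = 0" for k x
    using p(1)[of k] by (auto simp: P_def S_def E_def split: prod.splits)
  have E: "E k \<subseteq> E (Suc k)"
    and S_Suc: "x \<in> near c (E k) \<Longrightarrow> lip0_apply (S (Suc k)) x = lip0_apply (S k) x"
    and jump: "\<exists>m\<ge>k. \<exists>n\<ge>k. \<forall>g. norm g \<le> 1 + 4 * c \<longrightarrow>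
      (\<forall>x\<in>E (Suc k). lip0_apply g x = lip0_apply (S (Suc k)) x) \<longrightarrow>
      e / 2 \<le> \<bar>blinfun_apply (u n) g - blinfun_apply (u m) g\<bar>" for k x
    using p(2)[of k] by (auto simp: Q_def S_def E_def split: prod.splits)
  have near: "near c (E k) \<subseteq> near c (E j)" if "k \<le> j" for k j
    using c lift_Suc_mono_le[of E, OF E that] by (rule near_mono)
  have S_eq: "lip0_apply (S j) x = lip0_apply (S k) x" if "k \<le> j" "x \<in> near c (E k)" for k j x
    using that(1)
  proof (induction rule: dec_induct)
    case (step j)
    then show ?case using S_Suc[of x j] near[of k j] that(2) by auto
  qed simp
  have lim_S: "(\<lambda>j. lip0_apply (S j) x) \<longlonglongrightarrow> lip0_apply (S k) x" if "x \<in> near c (E k)" for k x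
    by (rule tendsto_eventually, rule eventually_sequentiallyI[of k]) (use S_eq that in auto)
  have "convergent (\<lambda>j. lip0_apply (S j) x)" for x
  \<comment> \<open>Either the values at \<open>x\<close> are eventually constant, or
    \<open>x\<close> lies outside every neighbourhood and they are all 0.\<close>
  proof (cases "\<exists>k. x \<in> near c (E k)")
    case True
    then show ?thesis using lim_S by (auto simp: convergent_def)
  next
    case False
    then show ?thesis using S(2)[of x] by (simp add: convergent_const)
  qed
  then obtain s where s: "\<And>x. (\<lambda>j. lip0_apply (S j) x) \<longlonglongrightarrow> s x"
    unfolding convergent_def by metis
  have "(1 + 4 * c)-lipschitz_on UNIV s"
  proof (rule lipschitz_onI)
    fix x y
    have "(\<lambda>j. dist (lip0_apply (S j) x) (lip0_apply (S j) y)) \<longlonglongrightarrow> dist (s x) (s y)"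
      by (intro tendsto_dist s)
    moreover have "dist (lip0_apply (S j) x) (lip0_apply (S j) y) \<le> (1 + 4 * c) * dist x y" for j
      using lip0_diff_le[of "S j" x y] mult_right_mono[OF S(1)[of j], of "dist x y"]
      by (simp add: dist_real_def)
    ultimately show "dist (s x) (s y) \<le> (1 + 4 * c) * dist x y"
      by (intro LIMSEQ_le_const2) auto
  qed (use c in simp)
  moreover have "s 0 = 0" using s[of 0] by (simp add: LIMSEQ_const_iff)
  ultimately obtain G where G: "lip0_apply G = s" "norm G \<le> 1 + 4 * c"
    using lip0_exists by blast
  have G_eq: "lip0_apply G x = lip0_apply (S k) x" if "x \<in> E k" for x k
    using lim_S[of x k] s[of x] subset_near[of "E k" c] that G(1) by (auto intro: LIMSEQ_unique)
  have "Cauchy (\<lambda>n. blinfun_apply (u n) G)" using conv Cauchy_convergent_iff by blast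
  then obtain k where k: "\<And>m n. m \<ge> k \<Longrightarrow> n \<ge> k \<Longrightarrow>
      \<bar>blinfun_apply (u n) G - blinfun_apply (u m) G\<bar> < e / 2"
    using e unfolding Cauchy_def dist_real_def by (metis half_gt_zero)
  have "\<forall>x\<in>E (Suc k). lip0_apply G x = lip0_apply (S (Suc k)) x"
    using G_eq by blast
  with jump[of k] G(2) obtain m n where "m \<ge> k" "n \<ge> k"
    "e / 2 \<le> \<bar>blinfun_apply (u n) G - blinfun_apply (u m) G\<bar>"
    by blast
  with k[of m n] show False by linarith
qed

text \<open>The positive and negative parts of the normalised function have norm at most 1 and
  vanish where it does; each costs e / 2.\<close>

lemma weakly_Cauchy_small_off_near:
  fixes u :: "nat \<Rightarrow> 'a::{metric_space,zero} lip0 \<Rightarrow>\<^sub>L real"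
  assumes u: "\<And>n. u n \<in> lip_free UNIV"
    and conv: "\<And>f. convergent (\<lambda>n. blinfun_apply (u n) f)"
    and c: "0 \<le> c" and e: "0 < e"
  obtains E where "finite E"
    "\<And>n f. (\<And>x. x \<in> near c E \<Longrightarrow> lip0_apply f x = 0) \<Longrightarrow>
      \<bar>blinfun_apply (u n) f\<bar> \<le> e * norm f"
proof -
  obtain E where E: "finite E"
    "\<And>n f. norm f \<le> 1 \<Longrightarrow> (\<And>x. 0 \<le> lip0_apply f x) \<Longrightarrow>
      (\<And>x. x \<in> near c E \<Longrightarrow> lip0_apply f x = 0) \<Longrightarrow> \<bar>blinfun_apply (u n) f\<bar> \<le> e / 2"
    using weakly_Cauchy_small_off_near_nonneg[OF u conv c half_gt_zero[OF e]] by blast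
  show thesis
  proof (rule that[OF E(1)])
    fix n and f :: "'a lip0" assume f: "\<And>x. x \<in> near c E \<Longrightarrow> lip0_apply f x = 0"
    show "\<bar>blinfun_apply (u n) f\<bar> \<le> e * norm f"
    proof (cases "f = 0")
      case False
      define g where "g = f /\<^sub>R norm f"
      have g: "norm g \<le> 1" "\<And>x. x \<in> near c E \<Longrightarrow> lip0_apply g x = 0"
        using f False by (simp_all add: g_def scaleR_lip0.rep_eq)
      have pos: "\<exists>p. lip0_apply p = (\<lambda>x. max 0 (lip0_apply h x)) \<and> norm p \<le> 1"
        if "norm h \<le> 1" for h :: "'a lip0"
      proof -
        have "1-lipschitz_on UNIV (\<lambda>x. max 0 (lip0_apply h x))"
          using that
          by (intro lipschitz_on_max lipschitz_on_mono[OF norm_lip0_lipschitz])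
            (auto simp: lipschitz_on_def)
        then show ?thesis by (rule lip0_exists[rotated]) auto
      qed
      obtain p where p: "lip0_apply p = (\<lambda>x. max 0 (lip0_apply g x))" "norm p \<le> 1"
        using pos[OF g(1)] by blast
      obtain q where q: "lip0_apply q = (\<lambda>x. max 0 (lip0_apply (- g) x))" "norm q \<le> 1"
        using pos[of "- g"] g(1) by auto
      have "g = p - q"
        by (rule lip0_eqI) (auto simp: p q minus_lip0.rep_eq uminus_lip0.rep_eq)
      moreover have "\<bar>blinfun_apply (u n) p\<bar> \<le> e / 2" "\<bar>blinfun_apply (u n) q\<bar> \<le> e / 2"
        by (rule E(2)[OF p(2)]; use p g in simp)
          (rule E(2)[OF q(2)]; use q g in \<open>simp add: uminus_lip0.rep_eq\<close>)
      ultimately have "\<bar>blinfun_apply (u n) g\<bar> \<le> e"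
        by (simp add: blinfun.diff_right)
      then show ?thesis using False
        by (simp add: g_def blinfun.scaleR_right abs_mult field_simps)
    qed simp
  qed
qed

section \<open>Reduction to compact sets\<close>

lemma near_finite:
  assumes "finite E" "x \<in> near c E"
  obtains y where "y \<in> insert 0 E" "c * dist x y \<le> dist x 0"
proof -
  have fin: "finite (dist x ` insert 0 E)" "dist x ` insert 0 E \<noteq> {}" using assms(1) by auto
  have "infdist x (insert 0 E) = Min (dist x ` insert 0 E)"
    by (simp add: infdist_notempty cInf_eq_Min assms(1))
  with Min_in[OF fin] obtain y where y: "y \<in> insert 0 E" "infdist x (insert 0 E) = dist x y"
    by auto
  with assms(2) show thesis by (intro that[of y]) (auto simp: near_def)
qed

text \<open>Points of \<open>near (b j) (E j)\<close> are within \<open>dist x 0 / b j\<close> of a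
  finite set once \<open>b j\<close> is positive. One \<open>b j\<close> bounds the sequence, larger
  ones then give finite nets at every scale, and completeness yields a limit. Membership is asked
  only eventually, so that \<open>x k\<close> may lie in just the first \<open>k\<close>
  sets.\<close>

lemma near_sequence_cluster_point:
  fixes x :: "nat \<Rightarrow> 'a::{complete_space,zero}"
  assumes E: "\<And>j::nat. finite (E j)" and b: "\<And>B. \<exists>j. B \<le> b j"
    and x: "\<And>j. \<forall>\<^sub>F k in sequentially. x k \<in> near (b j) (E j)"
  obtains l r where "strict_mono r" "(x \<circ> r) \<longlonglongrightarrow> l" "\<And>j. l \<in> near (b j) (E j)"
proof -
  \<comment> \<open>With factor 2, the bound 2 d(x,y) \<le> d(x,0) \<le> d(x,y) + R gives d(x,y)
    \<le> R, hence d(x,0) \<le> 2 R.\<close>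
  obtain j0 where j0: "2 \<le> b j0" using b by blast
  have "bounded (insert 0 (E j0))" using E by (intro finite_imp_bounded) simp
  then obtain R where R: "\<And>y. y \<in> insert 0 (E j0) \<Longrightarrow> dist y 0 \<le> R"
    by (metis bounded_any_center dist_commute)
  have "0 \<le> R" using R[of 0] by simp
  have far: "\<forall>\<^sub>F k in sequentially. dist (x k) 0 \<le> 2 * R"
    using x[of j0]
  proof eventually_elim
    case (elim k)
    then obtain y where y: "y \<in> insert 0 (E j0)" "b j0 * dist (x k) y \<le> dist (x k) 0"
      using near_finite E by blast
    have "2 * dist (x k) y \<le> b j0 * dist (x k) y" using j0 by (intro mult_right_mono) auto
    then show ?case using y(2) R[OF y(1)] dist_triangle[of "x k" 0 y] by linarith
  qed
  have "\<exists>F. finite F \<and> closure (range x) \<subseteq> (\<Union>y\<in>F. ball y e)" if e: "0 < e" for e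
  proof -
    \<comment> \<open>Chosen so that 2 R \<le> b j * (e / 2); the summand 1 keeps \<open>b j\<close>
      positive when \<open>R\<close> is 0.\<close>
    obtain j where j: "4 * R / e + 1 \<le> b j" using b by blast
    then have bj: "0 < b j" using \<open>0 \<le> R\<close> e by (smt (verit) divide_nonneg_pos)
    have "4 * R / e \<le> b j" using j by linarith
    then have bR: "4 * R \<le> b j * e" using e by (simp add: divide_le_eq)
    have "\<forall>\<^sub>F k in sequentially. \<exists>y\<in>insert 0 (E j). dist y (x k) \<le> e / 2"
      using far x[of j]
    proof eventually_elim
      case (elim k)
      then obtain y where y: "y \<in> insert 0 (E j)" "b j * dist (x k) y \<le> dist (x k) 0"
        using near_finite E by blast
      then have "b j * dist (x k) y \<le> b j * (e / 2)" using elim bR by simp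
      with bj have "dist (x k) y \<le> e / 2" by simp
      with y(1) show ?case by (auto simp: dist_commute)
    qed
    then obtain N where N: "\<And>k. k \<ge> N \<Longrightarrow> \<exists>y\<in>insert 0 (E j). dist y (x k) \<le> e / 2"
      by (auto simp: eventually_sequentially)
    define F where "F = insert 0 (E j) \<union> x ` {..<N}"
    have fin: "finite F" using E by (simp add: F_def)
    have "x k \<in> (\<Union>y\<in>F. cball y (e / 2))" for k
      using N[of k] e by (cases "k < N") (force simp: F_def)+
    then have "closure (range x) \<subseteq> (\<Union>y\<in>F. cball y (e / 2))"
      using fin by (intro closure_minimal closed_UN) auto
    also have "\<dots> \<subseteq> (\<Union>y\<in>F. ball y e)" using e by fastforce
    finally show ?thesis using fin by blast
  qed
  then have "compact (closure (range x))"
    unfolding compact_eq_totally_bounded complete_eq_closed by auto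
  then have "seq_compact (closure (range x))" by (rule compact_imp_seq_compact)
  moreover have "\<forall>k. x k \<in> closure (range x)"
    by (intro allI subsetD[OF closure_subset] rangeI)
  ultimately obtain l r where lr: "strict_mono r" "(x \<circ> r) \<longlonglongrightarrow> l"
    by (rule seq_compactE)
  show thesis
  proof (rule that[OF lr])
    fix j
    have "\<forall>\<^sub>F k in sequentially. (x \<circ> r) k \<in> near (b j) (E j)"
      using eventually_subseq[OF lr(1) x[of j]] by simp
    then show "l \<in> near (b j) (E j)"
      using lr(2) by (intro Lim_in_closed_set[OF closed_near]) auto
  qed
qed

lemma compact_Inter_near:
  fixes E :: "nat \<Rightarrow> 'a::{complete_space,zero} set"
  assumes "\<And>j. finite (E j)" "\<And>B. \<exists>j. B \<le> b j"
  shows "compact (\<Inter>j. near (b j) (E j))"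
  unfolding compact_eq_seq_compact_metric seq_compact_def
proof (intro allI impI)
  fix x :: "nat \<Rightarrow> 'a" assume "\<forall>k. x k \<in> (\<Inter>j. near (b j) (E j))"
  then have x: "\<forall>\<^sub>F k in sequentially. x k \<in> near (b j) (E j)" for j by simp
  obtain l r where "strict_mono r" "(x \<circ> r) \<longlonglongrightarrow> l" "\<And>j. l \<in> near (b j) (E j)"
    using near_sequence_cluster_point[of E b x, OF assms x] by blast
  then show "\<exists>l\<in>\<Inter>j. near (b j) (E j). \<exists>r. strict_mono r \<and> (x \<circ> r) \<longlonglongrightarrow> l" by blast
qed

text \<open>Counterexamples \<open>x k\<close> for every \<open>k\<close> would have a cluster point
  in the full intersection, although each \<open>x k\<close> keeps distance at least
  \<open>r\<close> from that set.\<close>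

lemma near_Inter_near:
  fixes E :: "nat \<Rightarrow> 'a::{complete_space,zero} set"
  assumes E: "\<And>j. finite (E j)" "\<And>B. \<exists>j. B \<le> b j" and r: "0 < r"
  obtains k where "\<And>x. (\<And>j. j < k \<Longrightarrow> x \<in> near (b j) (E j)) \<Longrightarrow>
    \<exists>y\<in>(\<Inter>j. near (b j) (E j)). dist x y < r"
proof -
  let ?K = "\<Inter>j. near (b j) (E j)"
  have "\<exists>k. \<forall>x. (\<forall>j<k. x \<in> near (b j) (E j)) \<longrightarrow> (\<exists>y\<in>?K. dist x y < r)"
  proof (rule ccontr)
    assume "\<not> ?thesis"
    then obtain x where x: "\<And>k j. j < k \<Longrightarrow> x k \<in> near (b j) (E j)"
      "\<And>k y. y \<in> ?K \<Longrightarrow> \<not> dist (x k) y < r"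
      by metis
    have ev: "\<forall>\<^sub>F k in sequentially. x k \<in> near (b j) (E j)" for j
      using eventually_gt_at_top[of j] by eventually_elim (rule x(1))
    obtain l s where ls: "strict_mono s" "(x \<circ> s) \<longlonglongrightarrow> l" "\<And>j. l \<in> near (b j) (E j)"
      using near_sequence_cluster_point[of E b x, OF E ev] by blast
    have "\<forall>\<^sub>F k in sequentially. dist ((x \<circ> s) k) l < r"
      using ls(2) r by (rule tendstoD)
    with x(2)[of l] ls(3) show False by simp
  qed
  then show thesis using that by blast
qed

section \<open>Cutoffs acting on the free space\<close>

lemma lip_free_compose_cutoff:
  assumes "\<mu> \<in> lip_free UNIV"
  shows "\<mu> o\<^sub>L cutoff c E \<in> lip_free UNIV"
proof -
  \<comment> \<open>The adjoint multiplies \<open>delta x\<close> by the number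
    \<open>cutoff_weight c E x\<close>, so it maps the span into the free space.\<close>
  have span: "\<nu> o\<^sub>L cutoff c E \<in> lip_free UNIV" if "\<nu> \<in> span (range delta)" for \<nu>
    using that
  proof (induction rule: span_induct_alt)
    case base
    have "0 o\<^sub>L cutoff c E = 0" by (rule blinfun_eqI) simp
    then show ?case by (simp add: subspace_0 subspace_lip_free)
  next
    case (step a \<mu> \<nu>)
    then obtain x where "\<mu> = delta x" by blast
    then have "(a *\<^sub>R \<mu> + \<nu>) o\<^sub>L cutoff c E =
        (a * cutoff_weight c E x) *\<^sub>R delta x + (\<nu> o\<^sub>L cutoff c E)"
      by (intro blinfun_eqI) (simp add: blinfun.bilinear_simps cutoff_apply)
    with step show ?case
      by (auto intro!: subspace_add subspace_scale subspace_lip_free delta_in_lip_free)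
  qed
  from assms obtain v where v: "\<And>n. v n \<in> span (range delta)" "v \<longlonglongrightarrow> \<mu>"
    unfolding lip_free_def by (auto simp: closure_sequential)
  have "(\<lambda>n. v n o\<^sub>L cutoff c E) \<longlonglongrightarrow> (\<mu> o\<^sub>L cutoff c E)"
    by (intro bounded_bilinear.tendsto[OF bounded_bilinear_blinfun_compose] v tendsto_const)
  then show ?thesis
    by (rule closed_sequentially[OF closed_lip_free span[OF v(1)]])
qed

text \<open>The part of \<open>f\<close> removed by the cutoff vanishes on \<open>near c E\<close>
  and has norm at most (2 + 2c) \<open>norm f\<close>, which explains the precision demanded of
  \<open>E\<close>.\<close>

lemma cutoff_approximation:
  fixes u :: "nat \<Rightarrow> 'a::{metric_space,zero} lip0 \<Rightarrow>\<^sub>L real"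
  assumes u: "\<And>n. u n \<in> lip_free UNIV"
    and conv: "\<And>f. convergent (\<lambda>n. blinfun_apply (u n) f)"
    and c: "0 \<le> c" and e: "0 < e"
  obtains E where "finite E" "\<And>n. norm (u n - (u n o\<^sub>L cutoff c E)) \<le> e"
proof -
  have "0 < e / (2 + 2 * c)" using c e by simp
  then obtain E where E: "finite E"
    "\<And>n f. (\<And>x. x \<in> near c E \<Longrightarrow> lip0_apply f x = 0) \<Longrightarrow>
      \<bar>blinfun_apply (u n) f\<bar> \<le> e / (2 + 2 * c) * norm f"
    by (rule weakly_Cauchy_small_off_near[OF u conv c]) blast
  show thesis
  proof (rule that[OF E(1)], rule norm_blinfun_bound)
    fix n f
    define g where "g = f - blinfun_apply (cutoff c E) f"
    have "norm g \<le> norm f + norm (blinfun_apply (cutoff c E) f)"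
      unfolding g_def by (rule norm_triangle_ineq4)
    also have "\<dots> \<le> (2 + 2 * c) * norm f"
      using norm_cutoff_le[of c E f] c by (simp add: algebra_simps)
    finally have norm_g: "norm g \<le> (2 + 2 * c) * norm f" .
    have "norm (blinfun_apply (u n - (u n o\<^sub>L cutoff c E)) f) = \<bar>blinfun_apply (u n) g\<bar>"
      by (simp add: g_def blinfun.bilinear_simps)
    also have "\<dots> \<le> e / (2 + 2 * c) * norm g"
      by (rule E(2)) (simp add: g_def minus_lip0.rep_eq cutoff_apply cutoff_weight_near)
    also have "\<dots> \<le> e / (2 + 2 * c) * ((2 + 2 * c) * norm f)"
      using c e by (intro mult_left_mono norm_g) auto
    also have "\<dots> = e * norm f" using c by (simp add: add_nonneg_eq_0_iff)
    finally show "norm (blinfun_apply (u n - (u n o\<^sub>L cutoff c E)) f) \<le> e * norm f" .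
  qed (use e in simp)
qed

text \<open>\<open>v k\<close> pairs \<open>f\<close> through its product with the first
  \<open>k\<close> weights, and this product is identically 0: outside the intersection one of the
  weights vanishes, inside it \<open>f\<close> does.\<close>

lemma vanish_off_Inter_near:
  fixes v :: "nat \<Rightarrow> 'a::{metric_space,zero} lip0 \<Rightarrow>\<^sub>L real"
  assumes v: "\<And>k. v (Suc k) = v k o\<^sub>L cutoff (c k) (E k)"
    and f: "\<And>x. (\<And>j. j < k \<Longrightarrow> x \<in> near (c j / 2) (E j)) \<Longrightarrow> lip0_apply f x = 0"
  shows "blinfun_apply (v k) f = 0"
  using f
proof (induction k arbitrary: f)
  case 0
  then have "f = 0" by (intro lip0_eqI) (simp add: zero_lip0.rep_eq)
  then show ?case by simp
next
  case (Suc k)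
  have "blinfun_apply (v k) (blinfun_apply (cutoff (c k) (E k)) f) = 0"
  proof (rule Suc.IH)
    fix x assume x: "\<And>j. j < k \<Longrightarrow> x \<in> near (c j / 2) (E j)"
    show "lip0_apply (blinfun_apply (cutoff (c k) (E k)) f) x = 0"
    proof (cases "x \<in> near (c k / 2) (E k)")
      case True
      with x have "lip0_apply f x = 0" by (intro Suc.prems) (auto simp: less_Suc_eq)
      then show ?thesis by (simp add: cutoff_apply)
    qed (simp add: cutoff_apply cutoff_weight_not_near)
  qed
  then show ?case by (simp add: v)
qed

section \<open>Limits of functionals and truncation of functions\<close>

lemma geometric_limit:
  fixes v :: "nat \<Rightarrow> 'b::banach"
  assumes step: "\<And>k. norm (v k - v (Suc k)) \<le> e / 2 ^ Suc k"
  obtains w where "v \<longlonglongrightarrow> w" "\<And>k. norm (v k - w) \<le> e / 2 ^ k"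
proof -
  have "0 \<le> e" using order_trans[OF norm_ge_zero step[of 0]] by simp
  \<comment> \<open>The subtracted term makes the induction close: the next step adds e / 2 ^ Suc j,
    exactly the difference of two consecutive such terms.\<close>
  have gap: "norm (v k - v j) \<le> e / 2 ^ k - e / 2 ^ j" if "k \<le> j" for k j
    using that
  proof (induction rule: dec_induct)
    case (step j)
    have "norm (v k - v (Suc j)) \<le> norm (v k - v j) + norm (v j - v (Suc j))"
      using norm_triangle_ineq[of "v k - v j" "v j - v (Suc j)"] by simp
    with step assms[of j] show ?case by simp
  qed simp
  have lim0: "(\<lambda>k. e / 2 ^ k) \<longlonglongrightarrow> 0"
    using LIMSEQ_divide_realpow_zero[of 2 e] by simp
  have "Cauchy v"
  proof (rule metric_CauchyI)
    fix d :: real assume "0 < d"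
    with lim0 obtain N where N: "\<And>k. N \<le> k \<Longrightarrow> \<bar>e / 2 ^ k\<bar> < d"
      by (auto simp: LIMSEQ_iff)
    have less: "dist (v k) (v j) < d" if "N \<le> k" "k \<le> j" for k j
    proof -
      have "0 \<le> e / 2 ^ j" using \<open>0 \<le> e\<close> by simp
      then show ?thesis
        using gap[OF that(2)] abs_less_iff[THEN iffD1, OF N[OF that(1)]]
        unfolding dist_norm by linarith
    qed
    show "\<exists>N. \<forall>m\<ge>N. \<forall>n\<ge>N. dist (v m) (v n) < d"
      by (intro exI[of _ N] allI impI) (metis less dist_commute nle_le)
  qed
  then obtain w where w: "v \<longlonglongrightarrow> w" using Cauchy_convergent_iff convergent_def by blast
  show thesis
  proof (rule that[OF w])
    fix k
    have "(\<lambda>j. norm (v k - v j)) \<longlonglongrightarrow> norm (v k - w)" by (intro tendsto_intros w)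
    moreover have "norm (v k - v j) \<le> e / 2 ^ k" if "k \<le> j" for j
    proof -
      have "0 \<le> e / 2 ^ j" using \<open>0 \<le> e\<close> by simp
      then show ?thesis using gap[OF that] by simp
    qed
    ultimately show "norm (v k - w) \<le> e / 2 ^ k"
      by (intro LIMSEQ_le_const2) auto
  qed
qed

lemma convergent_blinfun_uniform_limit:
  fixes w :: "nat \<Rightarrow> 'b::real_normed_vector \<Rightarrow>\<^sub>L real"
  assumes "\<And>e. 0 < e \<Longrightarrow> \<exists>v. (\<forall>n. norm (v n - w n) \<le> e) \<and> convergent (\<lambda>n. blinfun_apply (v n) f)"
  shows "convergent (\<lambda>n. blinfun_apply (w n) f)"
proof -
  have "Cauchy (\<lambda>n. blinfun_apply (w n) f)"
  proof (rule metric_CauchyI)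
    fix d :: real assume d: "0 < d"
    define e where "e = d / (3 * (norm f + 1))"
    have "0 < norm f + 1" by (simp add: add_nonneg_pos)
    then have e: "0 < e" and ef: "e * norm f \<le> d / 3"
      using d by (simp_all add: e_def divide_simps)
    obtain v where v: "\<And>n. norm (v n - w n) \<le> e" "convergent (\<lambda>n. blinfun_apply (v n) f)"
      using assms[OF e(1)] by blast
    have vw: "\<bar>blinfun_apply (v n) f - blinfun_apply (w n) f\<bar> \<le> d / 3" for n
    proof -
      have "\<bar>blinfun_apply (v n - w n) f\<bar> \<le> norm (v n - w n) * norm f"
        using norm_blinfun[of "v n - w n" f] by simp
      also have "\<dots> \<le> e * norm f" by (intro mult_right_mono v) simp
      finally show ?thesis using ef by (simp add: blinfun.diff_left)
    qed
    have "Cauchy (\<lambda>n. blinfun_apply (v n) f)" using v(2) Cauchy_convergent_iff by blast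
    then obtain N where N: "\<And>m n. m \<ge> N \<Longrightarrow> n \<ge> N \<Longrightarrow>
        \<bar>blinfun_apply (v m) f - blinfun_apply (v n) f\<bar> < d / 3"
      using d unfolding Cauchy_def dist_real_def by (metis divide_pos_pos zero_less_numeral)
    have "dist (blinfun_apply (w m) f) (blinfun_apply (w n) f) < d" if "m \<ge> N" "n \<ge> N" for m n
      using N[OF that] vw[of m] vw[of n] unfolding dist_real_def by linarith
    then show "\<exists>N. \<forall>m\<ge>N. \<forall>n\<ge>N. dist (blinfun_apply (w m) f) (blinfun_apply (w n) f) < d"
      by blast
  qed
  then show ?thesis by (simp add: Cauchy_convergent_iff)
qed

text \<open>For a function vanishing on \<open>K\<close>, truncation at a small height leaves it
  unchanged near \<open>K\<close> and makes it uniformly small, at no cost in norm.\<close>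

lemma lip0_truncate:
  assumes "0 \<le> t"
  obtains g where "norm g \<le> norm f" "\<And>x. \<bar>lip0_apply g x\<bar> \<le> t"
    "\<And>x. \<bar>lip0_apply f x\<bar> \<le> t \<Longrightarrow> lip0_apply g x = lip0_apply f x"
proof -
  have "(norm f)-lipschitz_on UNIV (\<lambda>x. max (- t) (min t (lip0_apply f x)))"
  proof (rule lipschitz_onI)
    fix x y
    have "\<bar>max (- t) (min t (lip0_apply f x)) - max (- t) (min t (lip0_apply f y))\<bar>
        \<le> \<bar>lip0_apply f x - lip0_apply f y\<bar>" by linarith
    then show "dist (max (- t) (min t (lip0_apply f x))) (max (- t) (min t (lip0_apply f y)))
        \<le> norm f * dist x y"
      using lip0_diff_le[of f x y] by (simp add: dist_real_def)
  qed simp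
  then obtain g where g: "lip0_apply g = (\<lambda>x. max (- t) (min t (lip0_apply f x)))"
    "norm g \<le> norm f"
    using lip0_exists[of "\<lambda>x. max (- t) (min t (lip0_apply f x))" "norm f"] assms by auto
  then show thesis using assms by (intro that[of g]) auto
qed

lemma compact_reduction:
  fixes u :: "nat \<Rightarrow> 'a::{complete_space,zero} lip0 \<Rightarrow>\<^sub>L real"
  assumes u: "\<And>n. u n \<in> lip_free UNIV"
    and conv: "\<And>f. convergent (\<lambda>n. blinfun_apply (u n) f)" and e: "0 < e"
  obtains K w where "compact K" "\<And>n. w n \<in> lip_free K" "\<And>n. norm (u n - w n) \<le> e"
    "\<And>f. convergent (\<lambda>n. blinfun_apply (w n) f)"
proof -
  \<comment> \<open>The weight for \<open>c k\<close> lives on \<open>near (c k / 2)\<close>; these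
    parameters 2 ^ k are unbounded, as compactness of the intersection requires.\<close>
  define c :: "nat \<Rightarrow> real" where "c k = 2 ^ Suc k" for k
  \<comment> \<open>The clause for \<open>k = 0\<close> pins down the start, which dependent choice
    by itself leaves open.\<close>
  define P where "P k v \<longleftrightarrow> (\<forall>n. v n \<in> lip_free UNIV) \<and>
    (\<forall>f. convergent (\<lambda>n. blinfun_apply (v n) f)) \<and> (k = 0 \<longrightarrow> v = u)"
    for k :: nat and v :: "nat \<Rightarrow> 'a lip0 \<Rightarrow>\<^sub>L real"
  \<comment> \<open>Each stage cuts off the already modified sequence; the costs e / 2 ^ Suc k sum
    to \<open>e\<close>.\<close>
  define Q where "Q k v v' \<longleftrightarrow> (\<exists>E. finite E \<and> (\<forall>n. v' n = v n o\<^sub>L cutoff (c k) E) \<and>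
    (\<forall>n. norm (v n - v' n) \<le> e / 2 ^ Suc k))"
    for k :: nat and v v' :: "nat \<Rightarrow> 'a lip0 \<Rightarrow>\<^sub>L real"
  have "\<exists>v. \<forall>k. P k (v k) \<and> Q k (v k) (v (Suc k))"
  proof (rule dependent_nat_choice)
    show "\<exists>v. P 0 v" using u conv by (auto simp: P_def)
    fix v k assume "P k v"
    then have v: "\<And>n. v n \<in> lip_free UNIV" "\<And>f. convergent (\<lambda>n. blinfun_apply (v n) f)"
      by (auto simp: P_def)
    have "0 \<le> c k" "0 < e / 2 ^ Suc k" using e by (simp_all add: c_def)
    then obtain E where E: "finite E"
      "\<And>n. norm (v n - (v n o\<^sub>L cutoff (c k) E)) \<le> e / 2 ^ Suc k"
      by (rule cutoff_approximation[OF v]) blast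
    have "P (Suc k) (\<lambda>n. v n o\<^sub>L cutoff (c k) E)"
      using v by (simp add: P_def lip_free_compose_cutoff)
    moreover have "Q k v (\<lambda>n. v n o\<^sub>L cutoff (c k) E)"
      using E by (auto simp: Q_def)
    ultimately show "\<exists>v'. P (Suc k) v' \<and> Q k v v'" by blast
  qed
  then obtain v where v: "\<And>k. P k (v k)" "\<And>k. Q k (v k) (v (Suc k))" by blast
  have v_free: "v k n \<in> lip_free UNIV" and v_conv: "convergent (\<lambda>n. blinfun_apply (v k n) f)"
    for k n f using v(1)[of k] by (auto simp: P_def)
  have v0: "v 0 = u" using v(1)[of 0] by (simp add: P_def)
  obtain E where E: "\<And>k. finite (E k)"
    and v_Suc: "\<And>k n. v (Suc k) n = v k n o\<^sub>L cutoff (c k) (E k)"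
    and v_step: "\<And>k n. norm (v k n - v (Suc k) n) \<le> e / 2 ^ Suc k"
    using v(2) unfolding Q_def by metis
  have "\<exists>w. (\<lambda>k. v k n) \<longlonglongrightarrow> w \<and> (\<forall>k. norm (v k n - w) \<le> e / 2 ^ k)" for n
    using geometric_limit[of "\<lambda>k. v k n", OF v_step] by metis
  then obtain w where w: "\<And>n. (\<lambda>k. v k n) \<longlonglongrightarrow> w n"
    "\<And>k n. norm (v k n - w n) \<le> e / 2 ^ k"
    by metis
  define K where "K = (\<Inter>j. near (c j / 2) (E j))"
  have unb: "\<exists>j. B \<le> c j / 2" for B
    using real_arch_pow[of 2 B] by (auto simp: c_def intro: less_imp_le)
  show thesis
  proof (rule that[of K w])
    show "compact K"
      unfolding K_def by (rule compact_Inter_near[OF E unb])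
    show "norm (u n - w n) \<le> e" for n using w(2)[of 0 n] v0 by simp
    show "convergent (\<lambda>n. blinfun_apply (w n) f)" for f
    proof (rule convergent_blinfun_uniform_limit)
      fix d :: real assume "0 < d"
      then obtain k where "e / 2 ^ k < d"
        using order_tendstoD(2)[OF LIMSEQ_divide_realpow_zero[of 2 e]]
        by (auto simp: eventually_sequentially)
      then have "norm (v k n - w n) \<le> d" for n using w(2)[of k n] by linarith
      then show "\<exists>v. (\<forall>n. norm (v n - w n) \<le> d) \<and> convergent (\<lambda>n. blinfun_apply (v n) f)"
        using v_conv by blast
    qed
    fix n
    have w_free: "w n \<in> lip_free UNIV"
      using closed_sequentially[OF closed_lip_free _ w(1)] v_free by blast
    have w_zero: "blinfun_apply (w n) f = 0"
      if f: "\<And>x. (\<And>j. j < k \<Longrightarrow> x \<in> near (c j / 2) (E j)) \<Longrightarrow> lip0_apply f x = 0" for k f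
    proof -
      have "blinfun_apply (v m n) f = 0" if "k \<le> m" for m
        by (rule vanish_off_Inter_near[of "\<lambda>k. v k n", OF v_Suc]) (use f that in auto)
      then have "(\<lambda>m. blinfun_apply (v m n) f) \<longlonglongrightarrow> 0"
        by (intro tendsto_eventually eventually_sequentiallyI[of k])
      moreover have "(\<lambda>m. blinfun_apply (v m n) f) \<longlonglongrightarrow> blinfun_apply (w n) f"
        by (intro blinfun.tendsto w tendsto_const)
      ultimately show ?thesis using LIMSEQ_unique by blast
    qed
    show "w n \<in> lip_free K"
    proof (rule lip_free_annihilator[OF w_free])
      fix f assume f: "\<And>x. x \<in> K \<Longrightarrow> lip0_apply f x = 0"
      \<comment> \<open>On a late enough finite intersection every point is close to
        \<open>K\<close>, so \<open>f\<close> is small there and equals its truncation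
        \<open>g\<close>. Hence \<open>w n\<close> annihilates \<open>g - f\<close>.\<close>
      have "\<exists>g. norm g \<le> norm f \<and> (\<forall>x. \<bar>lip0_apply g x\<bar> \<le> norm f * inverse (real (Suc i))) \<and>
          blinfun_apply (w n) g = blinfun_apply (w n) f" for i
      proof -
        let ?r = "inverse (real (Suc i))"
        obtain k where k: "\<And>x. (\<And>j. j < k \<Longrightarrow> x \<in> near (c j / 2) (E j)) \<Longrightarrow>
            \<exists>y\<in>K. dist x y < ?r"
          unfolding K_def by (rule near_Inter_near[of E "\<lambda>j. c j / 2" ?r, OF E unb]) (simp, blast)
        obtain g where g: "norm g \<le> norm f" "\<And>x. \<bar>lip0_apply g x\<bar> \<le> norm f * ?r"
          "\<And>x. \<bar>lip0_apply f x\<bar> \<le> norm f * ?r \<Longrightarrow> lip0_apply g x = lip0_apply f x"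
          by (rule lip0_truncate[of "norm f * ?r" f]) auto
        have "blinfun_apply (w n) (g - f) = 0"
        proof (rule w_zero)
          fix x assume "\<And>j. j < k \<Longrightarrow> x \<in> near (c j / 2) (E j)"
          with k obtain y where y: "y \<in> K" "dist x y < ?r" by blast
          have "\<bar>lip0_apply f x\<bar> \<le> norm f * dist x y"
            using lip0_diff_le[of f x y] f[OF y(1)] by simp
          also have "\<dots> \<le> norm f * ?r" using y(2) by (intro mult_left_mono) auto
          finally show "lip0_apply (g - f) x = 0" by (simp add: minus_lip0.rep_eq g(3))
        qed
        with g(1,2) show ?thesis by (intro exI[of _ g]) (simp add: blinfun.diff_right)
      qed
      then obtain g where g: "\<And>i. norm (g i) \<le> norm f"
        "\<And>i x. \<bar>lip0_apply (g i) x\<bar> \<le> norm f * inverse (real (Suc i))"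
        "\<And>i. blinfun_apply (w n) (g i) = blinfun_apply (w n) f"
        by metis
      have "(\<lambda>i. lip0_apply (g i) x) \<longlonglongrightarrow> 0" for x
      proof (rule Lim_null_comparison)
        show "(\<lambda>i. norm f * inverse (real (Suc i))) \<longlonglongrightarrow> 0"
          by (intro tendsto_mult_right_zero LIMSEQ_inverse_real_of_nat)
        show "\<forall>\<^sub>F i in sequentially. norm (lip0_apply (g i) x) \<le> norm f * inverse (real (Suc i))"
          by (intro always_eventually allI) (simp only: real_norm_def g(2))
      qed
      \<comment> \<open>The pairings with \<open>g i\<close> tend to 0, yet all of them equal the
        pairing with \<open>f\<close>.\<close>
      then have "(\<lambda>i. blinfun_apply (w n) (g i)) \<longlonglongrightarrow> 0"
        using g(1) by (intro lip_free_bounded_pointwise_tendsto_zero[OF w_free])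
      then show "blinfun_apply (w n) f = 0" by (simp add: g(3) LIMSEQ_const_iff)
    qed
  qed
qed

section \<open>Norm estimates for weak limits and the equivalence\<close>

lemma blinfun_limit_diff_norm_le:
  fixes a b :: "nat \<Rightarrow> 'b::real_normed_vector \<Rightarrow>\<^sub>L real"
  assumes "\<And>f. (\<lambda>n. blinfun_apply (a n) f) \<longlonglongrightarrow> blinfun_apply x f"
    and "\<And>f. (\<lambda>n. blinfun_apply (b n) f) \<longlonglongrightarrow> blinfun_apply y f"
    and le: "\<And>n. norm (a n - b n) \<le> d"
  shows "norm (x - y) \<le> d"
proof (rule norm_blinfun_bound)
  show "0 \<le> d" using le[of 0] norm_ge_zero order_trans by blast
  fix f
  \<comment> \<open>Lower semicontinuity of the dual norm: an estimate at each fixed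
    \<open>f\<close> survives the limit.\<close>
  have "(\<lambda>n. norm (blinfun_apply (a n) f - blinfun_apply (b n) f)) \<longlonglongrightarrow>
      norm (blinfun_apply x f - blinfun_apply y f)"
    by (intro tendsto_intros assms)
  moreover have "norm (blinfun_apply (a n) f - blinfun_apply (b n) f) \<le> d * norm f" for n
    using order_trans[OF norm_blinfun[of "a n - b n" f] mult_right_mono[OF le norm_ge_zero]]
    by (simp add: blinfun.diff_left)
  ultimately show "norm (blinfun_apply (x - y) f) \<le> d * norm f"
    by (intro LIMSEQ_le_const2) (auto simp: blinfun.diff_left)
qed

theorem corollary2p4:
  shows "weakly_sequentially_complete (lip_free (UNIV :: 'a::{complete_space,zero} set)) \<longleftrightarrow>
    (\<forall>K :: 'a set. compact K \<longrightarrow> weakly_sequentially_complete (lip_free K))"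
proof (intro iffI allI impI)
  fix K :: "'a set"
  assume M: "weakly_sequentially_complete (lip_free (UNIV :: 'a set))"
  show "weakly_sequentially_complete (lip_free K)"
    unfolding weakly_sequentially_complete_lip_free_iff
  proof (intro allI impI)
    fix u assume u: "range u \<subseteq> lip_free K" and conv: "\<forall>f. convergent (\<lambda>n. blinfun_apply (u n) f)"
    have "range u \<subseteq> lip_free UNIV" using u lip_free_mono[of K UNIV] by blast
    with M conv obtain \<mu> where \<mu>: "\<mu> \<in> lip_free UNIV"
      "\<And>f. (\<lambda>n. blinfun_apply (u n) f) \<longlonglongrightarrow> blinfun_apply \<mu> f"
      unfolding weakly_sequentially_complete_lip_free_iff by blast
    \<comment> \<open>Every \<open>u n\<close> annihilates the functions that vanish on
      \<open>K\<close>, and this property passes to the pointwise limit.\<close>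
    have "\<mu> \<in> lip_free K"
    proof (rule lip_free_annihilator[OF \<mu>(1)])
      fix f assume f: "\<And>x. x \<in> K \<Longrightarrow> lip0_apply f x = 0"
      have "blinfun_apply (u n) f = 0" for n
        using lip_free_vanish[of "u n" K f] u f by blast
      with \<mu>(2)[of f] show "blinfun_apply \<mu> f = 0" by (simp add: LIMSEQ_const_iff)
    qed
    with \<mu>(2) show "\<exists>\<mu>\<in>lip_free K. \<forall>f. (\<lambda>n. blinfun_apply (u n) f) \<longlonglongrightarrow> blinfun_apply \<mu> f"
      by blast
  qed
next
  assume compact: "\<forall>K :: 'a set. compact K \<longrightarrow> weakly_sequentially_complete (lip_free K)"
  show "weakly_sequentially_complete (lip_free (UNIV :: 'a set))"
    unfolding weakly_sequentially_complete_lip_free_iff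
  proof (intro allI impI)
    fix u :: "nat \<Rightarrow> 'a lip0 \<Rightarrow>\<^sub>L real"
    assume u: "range u \<subseteq> lip_free UNIV" and conv: "\<forall>f. convergent (\<lambda>n. blinfun_apply (u n) f)"
    \<comment> \<open>The exponent \<open>k + 2\<close> makes the errors of stages \<open>k\<close>
      and \<open>k + 1\<close> sum to at most 1 / 2 ^ Suc k. The compact set varies with
      \<open>k\<close>, so the limits are collected in \<open>lip_free UNIV\<close>.\<close>
    have "\<exists>w x. (\<forall>n. norm (u n - w n) \<le> 1 / 2 ^ (k + 2)) \<and> x \<in> lip_free UNIV \<and>
        (\<forall>f. (\<lambda>n. blinfun_apply (w n) f) \<longlonglongrightarrow> blinfun_apply x f)" for k :: nat
    proof -
      obtain K w where K: "compact K" "\<And>n. w n \<in> lip_free K"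
        "\<And>n. norm (u n - w n) \<le> 1 / 2 ^ (k + 2)" "\<And>f. convergent (\<lambda>n. blinfun_apply (w n) f)"
        by (rule compact_reduction[of u "1 / 2 ^ (k + 2)"]) (use u conv in auto)
      then obtain x where "x \<in> lip_free K"
        "\<forall>f. (\<lambda>n. blinfun_apply (w n) f) \<longlonglongrightarrow> blinfun_apply x f"
        using compact unfolding weakly_sequentially_complete_lip_free_iff by blast
      with K(3) lip_free_mono[of K UNIV] show ?thesis by blast
    qed
    then obtain w x where w: "\<And>k n. norm (u n - w k n) \<le> 1 / 2 ^ (k + 2)"
      and x: "\<And>k. x k \<in> lip_free UNIV"
        "\<And>k f. (\<lambda>n. blinfun_apply (w k n) f) \<longlonglongrightarrow> blinfun_apply (x k) f"
      by metis
    have "norm (x k - x (Suc k)) \<le> 1 / 2 ^ Suc k" for k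
    proof (rule blinfun_limit_diff_norm_le[OF x(2) x(2)])
      fix n
      have "norm (w k n - w (Suc k) n) \<le> norm (u n - w k n) + norm (u n - w (Suc k) n)"
        by (metis norm_minus_commute dist_norm dist_triangle3 dist_commute)
      also have "\<dots> \<le> 1 / 2 ^ (k + 2) + 1 / 2 ^ (Suc k + 2)" by (intro add_mono w)
      also have "\<dots> \<le> 1 / 2 ^ Suc k" by (simp add: field_simps)
      finally show "norm (w k n - w (Suc k) n) \<le> 1 / 2 ^ Suc k" .
    qed
    then obtain \<mu> where \<mu>: "x \<longlonglongrightarrow> \<mu>" using geometric_limit by blast
    have "\<mu> \<in> lip_free UNIV" using closed_sequentially[OF closed_lip_free x(1) \<mu>] .
    moreover have "(\<lambda>n. blinfun_apply (u n) f) \<longlonglongrightarrow> blinfun_apply \<mu> f" for f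
    proof -
      \<comment> \<open>Both \<open>y\<close> and the pairing of \<open>\<mu>\<close> with
        \<open>f\<close> are limits of the pairings of \<open>x k\<close> with \<open>f\<close>: the
        former because \<open>w k\<close> is close to \<open>u\<close> uniformly in
        \<open>n\<close>, the latter because \<open>x\<close> converges in norm.\<close>
      obtain y where y: "(\<lambda>n. blinfun_apply (u n) f) \<longlonglongrightarrow> y"
        using conv by (auto simp: convergent_def)
      have "(\<lambda>k. blinfun_apply (x k) f) \<longlonglongrightarrow> y"
      proof (rule LIM_zero_cancel, rule Lim_null_comparison)
        show "(\<lambda>k. norm f * (1 / 2 ^ k)) \<longlonglongrightarrow> 0"
          using LIMSEQ_divide_realpow_zero[of 2 1] by (intro tendsto_mult_right_zero) simp
        show "\<forall>\<^sub>F k in sequentially. norm (blinfun_apply (x k) f - y) \<le> norm f * (1 / 2 ^ k)"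
        proof (intro always_eventually allI)
          fix k
          have "(\<lambda>n. norm (blinfun_apply (w k n) f - blinfun_apply (u n) f)) \<longlonglongrightarrow>
              norm (blinfun_apply (x k) f - y)"
            by (intro tendsto_intros x y)
          moreover have "norm (blinfun_apply (w k n) f - blinfun_apply (u n) f)
              \<le> norm f * (1 / 2 ^ k)" for n
          proof -
            have "norm (blinfun_apply (w k n) f - blinfun_apply (u n) f)
                \<le> norm (w k n - u n) * norm f"
              using norm_blinfun[of "w k n - u n" f] by (simp add: blinfun.diff_left)
            also have "\<dots> \<le> 1 / 2 ^ k * norm f"
            proof (rule mult_right_mono)
              have "norm (w k n - u n) \<le> 1 / 2 ^ (k + 2)" using w by (simp add: norm_minus_commute)
              also have "\<dots> \<le> 1 / 2 ^ k" by (intro divide_left_mono power_increasing) auto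
              finally show "norm (w k n - u n) \<le> 1 / 2 ^ k" .
            qed simp
            finally show ?thesis by (simp add: mult.commute)
          qed
          ultimately show "norm (blinfun_apply (x k) f - y) \<le> norm f * (1 / 2 ^ k)"
            by (intro LIMSEQ_le_const2) auto
        qed
      qed
      moreover have "(\<lambda>k. blinfun_apply (x k) f) \<longlonglongrightarrow> blinfun_apply \<mu> f"
        by (intro blinfun.tendsto \<mu> tendsto_const)
      ultimately show ?thesis using y LIMSEQ_unique by blast
    qed
    ultimately show "\<exists>\<mu>\<in>lip_free UNIV. \<forall>f. (\<lambda>n. blinfun_apply (u n) f) \<longlonglongrightarrow> blinfun_apply \<mu> f"
      by blast
  qed
qed

end
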